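(* Let $(M^2,T)$ be a closed two-dimensional triangulated manifold, let $U\subset V(T)^*$ be a simply connected open set, and let $\mathcal{C}:U\to\mathfrak{met}(M,T)$ be a conformal structure. For $f\in U$ let $K_i=K_i(f)$ be the curvature at the vertex $i$ of the piecewise flat metrized manifold $(M,T,\mathcal{C}[f])$. Then there is a function $F:U\to\mathbb{R}$ such that $$\frac{\partial F}{\partial f_i}=K_i\qquad\text{for each } i\in V(T).$$ Furthermore, for every smooth curve (conformal variation) $f:(-\varepsilon,\varepsilon)\to U$, the second variation of $F$ along $f(t)$ is $$\frac{d^2F}{dt^2}=\frac12\sum_{(i,j)\in E_+(T)}\frac{\ell_{ij}^*}{\ell_{ij}}\left(\frac{df_j}{dt}-\frac{df_i}{dt}\right)^2+\sum_{i\in V(T)}K_i\frac{d^2f_i}{dt^2},$$ where $\ell_{ij}$, $\ell^*_{ij}$, $K_i$ are those of the metric $\mathcal{C}[f(t)]$.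
   Context: A triangulated manifold $(M,T)$ is a topological manifold with a triangulation $T$ (here finite, and simplices are determined by their vertices and written $\{i,j,\dots,k\}$). $V(T)$, $E(T)$, $E_+(T)$ are the sets of vertices, edges, and directed edges (each edge $\{i,j\}$ gives two directed edges $(i,j)$ and $(j,i)$); $X^*$ is the vector space of functions $X\to\mathbb{R}$. $(M,T,\ell)$, with $\ell\in E(T)^*$, is piecewise flat if every simplex can be realized as a nondegenerate Euclidean simplex with edge lengths given by $\ell$. A (piecewise flat) metric is $d\in E_+(T)^*$ such that with $\ell_{ij}=d_{ij}+d_{ji}$, $(M,T,\ell)$ is piecewise flat, and for every triangle $\{i,j,k\}$: $d_{ij}^2+d_{jk}^2+d_{ki}^2=d_{ji}^2+d_{ik}^2+d_{kj}^2$. (The $d_{ij}$ may be negative.) Then $(M,T,d)$ is a piecewise flat metrized manifold; $\mathfrak{met}(M,T)$ is the set of all metrics $d$. A conformal structure on an open set $U\subset V(T)^*$ is a smooth map $\mathcal{C}:U\to\mathfrak{met}(M,T)\subset E_+(T)^*$ such that, writing $d=\mathcal{C}[f]$ and $\ell_{ij}=d_{ij}+d_{ji}$, for each $(i,j)\in E_+(T)$ and $k\in V(T)$: $\partial\ell_{ij}/\partial f_i=d_{ij}$, and $\partial d_{ij}/\partial f_k=0$ if $k\ne i$ and $k\neq j$. $\gamma_{i,jk}$ is the angle at vertex $i$ in the Euclidean triangle $\{i,j,k\}$ with edge lengths $\ell$. The curvature at $i$ is $K_i=2\pi-\sum\gamma_{i,jk}$, the sum being over all triangles $\{i,j,k\}$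 containing $i$. For a triangle $\{i,j,k\}$ set $h_{ij,k}=\dfrac{d_{ik}-d_{ij}\cos\gamma_{i,jk}}{\sin\gamma_{i,jk}}$ (the signed distance from the center of the triangle to the edge $\{i,j\}$; it is symmetric in $i,j$). The dual length of an edge $\{i,j\}$ contained in the two triangles $\{i,j,k\}$ and $\{i,j,\ell\}$ is $\ell_{ij}^*=h_{ij,k}+h_{ij,\ell}$. *)

theory Defs
  imports "HOL-Analysis.Analysis"
begin

section \<open>Calculus\<close>

text \<open>
  For open subsets of a finite-dimensional space this is the usual notion of a \<open>C\<^sup>\<infinity>\<close> map: there,
  \<open>g\<close> is of class \<open>Suc n\<close> iff it is differentiable and every directional derivative of \<open>g\<close> is of
  class \<open>n\<close>.
\<close>

primrec C_k_on :: "nat \<Rightarrow> 'a::real_normed_vector set \<Rightarrow> ('a \<Rightarrow> 'b::real_normed_vector) \<Rightarrow> bool"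
where
  "C_k_on 0 S g \<longleftrightarrow> continuous_on S g"
| "C_k_on (Suc n) S g \<longleftrightarrow>
    (\<forall>x\<in>S. g differentiable (at x)) \<and> (\<forall>v. C_k_on n S (\<lambda>x. frechet_derivative g (at x) v))"

definition smooth_on :: "'a::real_normed_vector set \<Rightarrow> ('a \<Rightarrow> 'b::real_normed_vector) \<Rightarrow> bool"
where
  "smooth_on S g \<longleftrightarrow> (\<forall>n. C_k_on n S g)"

definition has_partial_derivative :: "(real ^ 'v \<Rightarrow> real) \<Rightarrow> real \<Rightarrow> 'v::finite \<Rightarrow> real ^ 'v \<Rightarrow> bool"
where
  "has_partial_derivative g D k x \<longleftrightarrow>
    ((\<lambda>s. g (x + s *\<^sub>R axis k 1)) has_real_derivative D) (at 0)"

definition has_second_derivative :: "(real \<Rightarrow> real) \<Rightarrow> real \<Rightarrow> real \<Rightarrow> bool"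
where
  "has_second_derivative g D t \<longleftrightarrow>
    (\<forall>\<^sub>F s in nhds t. g differentiable (at s)) \<and> (deriv g has_real_derivative D) (at t)"


section \<open>Triangulated closed surfaces\<close>

definition closed_surface :: "'m topology \<Rightarrow> bool"
where
  "closed_surface M \<longleftrightarrow>
    compact_space M \<and> Hausdorff_space M \<and> second_countable M \<and>
    (\<forall>x\<in>topspace M. \<exists>N. openin M N \<and> x \<in> N \<and>
      (\<exists>W::(real ^ 2) set. open W \<and> subtopology M N homeomorphic_space top_of_set W))"

text \<open>
  A triangulation is a finite abstract simplicial complex, given by the vertex sets of its
  (nonempty) simplices. The set of vertices is the whole finite type \<open>'v\<close>, so that
  \<open>real ^ 'v\<close> is the space of real functions on the vertices.
\<close>

definition abstract_complex :: "'v::finite set set \<Rightarrow> bool"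
where
  "abstract_complex T \<longleftrightarrow>
    {} \<notin> T \<and> (\<forall>i. {i} \<in> T) \<and> (\<forall>\<sigma>\<in>T. \<forall>\<tau>. \<tau> \<subseteq> \<sigma> \<and> \<tau> \<noteq> {} \<longrightarrow> \<tau> \<in> T)"

definition geometric_realization :: "'v::finite set set \<Rightarrow> (real ^ 'v) set"
where
  "geometric_realization T = (\<Union>\<sigma>\<in>T. convex hull ((\<lambda>i. axis i 1) ` \<sigma>))"

definition triangulates :: "'v::finite set set \<Rightarrow> 'm topology \<Rightarrow> bool"
where
  "triangulates T M \<longleftrightarrow>
    abstract_complex T \<and> top_of_set (geometric_realization T) homeomorphic_space M"

definition directed_edges :: "'v set set \<Rightarrow> ('v \<times> 'v) set"
where
  "directed_edges T = {(i, j). i \<noteq> j \<and> {i, j} \<in> T}"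

definition triangles :: "'v set set \<Rightarrow> 'v set set"
where
  "triangles T = {\<tau> \<in> T. card \<tau> = 3}"


section \<open>Piecewise flat metrics\<close>

text \<open>
  Functions on edges and on directed edges are represented by functions of two vertices; only
  their values at the pairs in \<open>directed_edges T\<close> play a role. Any Euclidean simplex with
  vertices indexed by \<open>\<sigma>\<close> embeds isometrically into \<open>real ^ 'v\<close>, whatever its dimension.
\<close>

definition realizes_simplex :: "('v \<Rightarrow> 'v \<Rightarrow> real) \<Rightarrow> 'v::finite set \<Rightarrow> ('v \<Rightarrow> real ^ 'v) \<Rightarrow> bool"
where
  "realizes_simplex l \<sigma> p \<longleftrightarrow>
    inj_on p \<sigma> \<and> \<not> affine_dependent (p ` \<sigma>) \<and>
    (\<forall>i\<in>\<sigma>. \<forall>j\<in>\<sigma>. i \<noteq> j \<longrightarrow> dist (p i) (p j) = l i j)"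

definition piecewise_flat :: "'v::finite set set \<Rightarrow> ('v \<Rightarrow> 'v \<Rightarrow> real) \<Rightarrow> bool"
where
  "piecewise_flat T l \<longleftrightarrow> (\<forall>\<sigma>\<in>T. \<exists>p. realizes_simplex l \<sigma> p)"

definition edge_length :: "('v \<Rightarrow> 'v \<Rightarrow> real) \<Rightarrow> 'v \<Rightarrow> 'v \<Rightarrow> real"
where
  "edge_length d i j = d i j + d j i"

definition met :: "'v::finite set set \<Rightarrow> ('v \<Rightarrow> 'v \<Rightarrow> real) set"
where
  "met T = {d. piecewise_flat T (edge_length d) \<and>
    (\<forall>i j k. {i, j, k} \<in> triangles T \<longrightarrow>
      (d i j)\<^sup>2 + (d j k)\<^sup>2 + (d k i)\<^sup>2 = (d j i)\<^sup>2 + (d i k)\<^sup>2 + (d k j)\<^sup>2)}"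

definition conformal_structure ::
  "'v::finite set set \<Rightarrow> (real ^ 'v) set \<Rightarrow> (real ^ 'v \<Rightarrow> 'v \<Rightarrow> 'v \<Rightarrow> real) \<Rightarrow> bool"
where
  "conformal_structure T U \<C> \<longleftrightarrow>
    (\<forall>f\<in>U. \<C> f \<in> met T) \<and>
    (\<forall>(i, j)\<in>directed_edges T.
      smooth_on U (\<lambda>f. \<C> f i j) \<and>
      (\<forall>f\<in>U. has_partial_derivative (\<lambda>g. edge_length (\<C> g) i j) (\<C> f i j) i f \<and>
        (\<forall>k. k \<noteq> i \<and> k \<noteq> j \<longrightarrow> has_partial_derivative (\<lambda>g. \<C> g i j) 0 k f)))"


section \<open>Angles, curvature and dual lengths\<close>

definition vector_angle :: "'a::real_inner \<Rightarrow> 'a \<Rightarrow> real"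
where
  "vector_angle u v = arccos (u \<bullet> v / (norm u * norm v))"

text \<open>
  The angle at the vertex \<open>i\<close> of the Euclidean triangle with vertex set \<open>\<tau>\<close> and edge lengths
  \<open>l\<close>. It does not depend on the realization \<open>p\<close>; see \<open>triangle_angle_eq\<close> below.
\<close>

definition triangle_angle :: "('v \<Rightarrow> 'v \<Rightarrow> real) \<Rightarrow> 'v::finite \<Rightarrow> 'v set \<Rightarrow> real"
where
  "triangle_angle l i \<tau> =
    (THE \<theta>. \<exists>j k p. \<tau> = {i, j, k} \<and> i \<noteq> j \<and> i \<noteq> k \<and> j \<noteq> k \<and> realizes_simplex l \<tau> p \<and>
      \<theta> = vector_angle (p j - p i) (p k - p i))"

definition curvature :: "'v::finite set set \<Rightarrow> ('v \<Rightarrow> 'v \<Rightarrow> real) \<Rightarrow> 'v \<Rightarrow> real"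
where
  "curvature T d i = 2 * pi - (\<Sum>\<tau> | \<tau> \<in> triangles T \<and> i \<in> \<tau>. triangle_angle (edge_length d) i \<tau>)"

definition center_height :: "('v \<Rightarrow> 'v \<Rightarrow> real) \<Rightarrow> 'v::finite \<Rightarrow> 'v \<Rightarrow> 'v \<Rightarrow> real"
where
  "center_height d i j k =
    (let \<gamma> = triangle_angle (edge_length d) i {i, j, k}
     in (d i k - d i j * cos \<gamma>) / sin \<gamma>)"

text \<open>On a triangulated closed surface the sum has two terms, one for each triangle at the edge.\<close>

definition dual_length :: "'v::finite set set \<Rightarrow> ('v \<Rightarrow> 'v \<Rightarrow> real) \<Rightarrow> 'v \<Rightarrow> 'v \<Rightarrow> real"
where
  "dual_length T d i j = (\<Sum>k | {i, j, k} \<in> triangles T. center_height d i j k)"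

lemma vector_angle_law_of_cosines:
  fixes x y z :: "'a::real_inner"
  shows "vector_angle (y - x) (z - x) =
    arccos (((dist x y)\<^sup>2 + (dist x z)\<^sup>2 - (dist y z)\<^sup>2) / (2 * dist x y * dist x z))"
proof -
  have "(y - x) \<bullet> (z - x) = ((dist x y)\<^sup>2 + (dist x z)\<^sup>2 - (dist y z)\<^sup>2) / 2"
    by (simp add: dot_norm_neg dist_norm norm_minus_commute)
  then show ?thesis
    unfolding vector_angle_def by (simp only: dist_norm norm_minus_commute) (simp add: mult.assoc)
qed

lemma triangle_angle_eq:
  assumes "i \<noteq> j" "i \<noteq> k" "j \<noteq> k" and p: "realizes_simplex l {i, j, k} p"
  shows "triangle_angle l i {i, j, k} = vector_angle (p j - p i) (p k - p i)"
  unfolding triangle_angle_def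
proof (rule the_equality)
  show "\<exists>j' k' p'. {i, j, k} = {i, j', k'} \<and> i \<noteq> j' \<and> i \<noteq> k' \<and> j' \<noteq> k' \<and>
      realizes_simplex l {i, j, k} p' \<and>
      vector_angle (p j - p i) (p k - p i) = vector_angle (p' j' - p' i) (p' k' - p' i)"
    using assms by blast
next
  fix \<theta>
  assume "\<exists>j' k' p'. {i, j, k} = {i, j', k'} \<and> i \<noteq> j' \<and> i \<noteq> k' \<and> j' \<noteq> k' \<and>
      realizes_simplex l {i, j, k} p' \<and> \<theta> = vector_angle (p' j' - p' i) (p' k' - p' i)"
  then obtain j' k' p' where q: "{i, j, k} = {i, j', k'}" "i \<noteq> j'" "i \<noteq> k'" "j' \<noteq> k'"
      "realizes_simplex l {i, j, k} p'" "\<theta> = vector_angle (p' j' - p' i) (p' k' - p' i)"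
    by blast
  have dists: "dist (p' a) (p' b) = dist (p a) (p b)" if "a \<in> {i, j, k}" "b \<in> {i, j, k}" for a b
  proof (cases "a = b")
    case False
    then show ?thesis
      using p q(5) that unfolding realizes_simplex_def by metis
  qed simp
  have "j' = j \<and> k' = k \<or> j' = k \<and> k' = j"
    using q(1-4) assms(1-3) by auto
  then have "\<theta> = vector_angle (p' j - p' i) (p' k - p' i)"
    using q(6) by (auto simp: vector_angle_def inner_commute mult.commute)
  also have "\<dots> = vector_angle (p j - p i) (p k - p i)"
    by (simp add: vector_angle_law_of_cosines dists)
  finally show "\<theta> = vector_angle (p j - p i) (p k - p i)" .
qed

end

theory Submission
  imports Defs
begin

text \<open>
  The derivative of the curvature is a discrete Laplacian. In a triangle \<open>{i, j, k}\<close> with lengths \<open>\<ell>\<close>,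
  a conformal variation \<open>v = df/dt\<close> changes the angle at \<open>i\<close> by
  \<open>h\<^sub>i\<^sub>j\<^sub>,\<^sub>k / \<ell>\<^sub>i\<^sub>j * (v\<^sub>j - v\<^sub>i) + h\<^sub>i\<^sub>k\<^sub>,\<^sub>j / \<ell>\<^sub>i\<^sub>k * (v\<^sub>k - v\<^sub>i)\<close>
  (\<open>triangle_angle_has_derivative\<close>). This holds because the structure equations give
  \<open>d\<ell>\<^sub>i\<^sub>j/dt = d\<^sub>i\<^sub>j * v\<^sub>i + d\<^sub>j\<^sub>i * v\<^sub>j\<close>, and because the quadratic condition on a metric turns the law of cosines
  into a linear relation between the \<open>d\<close>'s (\<open>cosine_from_partial_lengths\<close>). Summed over the triangles at \<open>i\<close>,
  the heights over \<open>{i, j}\<close> add up to the dual length, and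
  \<open>dK\<^sub>i/dt = \<Sum>\<^sub>j w\<^sub>i\<^sub>j * (v\<^sub>i - v\<^sub>j)\<close> with \<open>w\<^sub>i\<^sub>j = \<ell>\<^sup>*\<^sub>i\<^sub>j / \<ell>\<^sub>i\<^sub>j\<close> (\<open>curvature_has_derivative\<close>).

  The distance from the center to an edge does not depend on the direction of the edge
  (\<open>center_height_commute\<close>), so the weights \<open>w\<close> are symmetric. Two consequences follow from summation by
  parts (\<open>laplacian_bilinear_form\<close>). First, the curvature is a vector field with symmetric derivative, which
  on a simply connected set is the gradient of a function \<open>F\<close> (\<open>closed_field_has_potential\<close>). Second, the
  quadratic form of the derivative of \<open>K\<close> is the sum of the \<open>w\<^sub>i\<^sub>j * (v\<^sub>j - v\<^sub>i)\<^sup>2 / 2\<close> over directed edges, which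
  together with the product rule is the formula for the second variation.

  The potential is obtained by gluing. Local potentials exist on balls by integration along radii. Their
  increments along a path, for a subdivision so fine that consecutive points lie in a common ball, have a sum
  that is invariant under homotopy: this is seen by subdividing the homotopy into small cells and telescoping
  (\<open>chain_sum_homotopic_paths\<close>).
\<close>


section \<open>Path sums of local increments\<close>

text \<open>
  Increments of local potentials without the potentials: on each ball inside \<open>U\<close>, \<open>I a b\<close> is a
  difference of values at \<open>b\<close> and \<open>a\<close> of some function, and what follows needs only the resulting
  additivity.
\<close>

definition additive_on_balls :: "'a::metric_space set \<Rightarrow> ('a \<Rightarrow> 'a \<Rightarrow> real) \<Rightarrow> bool"
where
  "additive_on_balls U I \<longleftrightarrow>
    (\<forall>x e. ball x e \<subseteq> U \<longrightarrow>
      (\<forall>a\<in>ball x e. \<forall>b\<in>ball x e. \<forall>c\<in>ball x e. I a b + I b c = I a c))"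

lemma additive_on_ballsD:
  assumes "additive_on_balls U I" "ball x e \<subseteq> U" "a \<in> ball x e" "b \<in> ball x e" "c \<in> ball x e"
  shows "I a b + I b c = I a c"
  using assms unfolding additive_on_balls_def by blast

text \<open>
  A Riemann sum for the integral of \<open>I\<close> along \<open>g\<close>. For continuous \<open>g\<close> no limit is involved: as soon as
  consecutive points share a ball inside \<open>U\<close>, additivity makes the increments exact.
\<close>

definition chain_sum :: "('a \<Rightarrow> 'a \<Rightarrow> real) \<Rightarrow> (real \<Rightarrow> 'a) \<Rightarrow> nat \<Rightarrow> real"
where
  "chain_sum I g N = (\<Sum>n<N. I (g (real n / real N)) (g (real (Suc n) / real N)))"

text \<open>
  A discrete Stokes theorem. The homotopy is sampled on an \<open>N \<times> N\<close> grid; adjacent rows of the grid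
  have the same sum, because the contributions \<open>V\<close> of the transversal steps telescope along a row.
\<close>

lemma chain_sum_homotopic_paths:
  fixes U :: "'a::real_normed_vector set"
  assumes I: "additive_on_balls U I" and U: "open U" and pq: "homotopic_paths U p q"
  shows "\<forall>\<^sub>F N in sequentially. chain_sum I p N = chain_sum I q N"
proof -
  let ?Q = "{0..1::real} \<times> {0..1::real}"
  obtain h where h: "continuous_on ?Q h" "h ` ?Q \<subseteq> U"
    and h0: "\<And>s. s \<in> {0..1} \<Longrightarrow> h (0, s) = p s" and h1: "\<And>s. s \<in> {0..1} \<Longrightarrow> h (1, s) = q s"
    and ends: "\<And>t. t \<in> {0..1} \<Longrightarrow> h (t, 0) = p 0" "\<And>t. t \<in> {0..1} \<Longrightarrow> h (t, 1) = p 1"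
  proof -
    from pq obtain h where "continuous_on ?Q h" "h \<in> ?Q \<rightarrow> U"
        "\<forall>s\<in>{0..1}. h (0, s) = p s" "\<forall>s\<in>{0..1}. h (1, s) = q s"
        "\<forall>t\<in>{0..1}. h (t, 0) = p 0 \<and> h (t, 1) = p 1"
      unfolding homotopic_paths by (auto simp: pathstart_def pathfinish_def)
    then show ?thesis
      by (intro that[of h]) blast+
  qed
  have "compact (h ` ?Q)"
    by (intro compact_continuous_image h compact_Times compact_Icc)
  then obtain e where e: "e > 0" "(\<Union>x\<in>h ` ?Q. ball x e) \<subseteq> U"
    using compact_subset_open_imp_ball_epsilon_subset U h(2) by metis
  have "uniformly_continuous_on ?Q h"
    by (intro compact_uniformly_continuous h compact_Times compact_Icc)
  then obtain \<delta> where \<delta>: "\<delta> > 0"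
      "\<And>x y. x \<in> ?Q \<Longrightarrow> y \<in> ?Q \<Longrightarrow> dist y x < \<delta> \<Longrightarrow> dist (h y) (h x) < e"
    using e(1) unfolding uniformly_continuous_on_def by metis
  \<comment> \<open>Once the mesh is below half of \<open>\<delta>\<close>, the four images of the corners of each grid cell lie in one
    ball of radius \<open>e\<close> inside \<open>U\<close>.\<close>
  have "chain_sum I p N = chain_sum I q N" if N: "2 / \<delta> < real N" for N
  proof -
    have "N > 0"
      using N \<delta>(1) by (auto intro!: Nat.gr0I)
    have small: "2 / real N < \<delta>"
      using N \<delta>(1) \<open>N > 0\<close> by (simp add: field_simps)
    define x where "x m n = h (real m / real N, real n / real N)" for m n :: nat
    define V where "V m n = I (x m n) (x (Suc m) n)" for m n
    define S where "S m = (\<Sum>n<N. I (x m n) (x m (Suc n)))" for m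
    have near: "x m' n' \<in> ball (x m n) e"
      if "m < N" "n < N" "m' \<in> {m, Suc m}" "n' \<in> {n, Suc n}" for m n m' n'
    proof -
      have "dist (real m / real N, real n / real N) (real m' / real N, real n' / real N)
          \<le> \<bar>real m / real N - real m' / real N\<bar> + \<bar>real n / real N - real n' / real N\<bar>"
        unfolding dist_Pair_Pair dist_real_def power2_abs by (rule sqrt_sum_squares_le_sum_abs)
      also have "\<dots> \<le> 1 / real N + 1 / real N"
        using that(3,4) \<open>N > 0\<close> by (intro add_mono) (auto simp: field_simps)
      also have "\<dots> < \<delta>"
        using small by simp
      finally have "dist (h (real m / real N, real n / real N)) (h (real m' / real N, real n' / real N)) < e"
        using that \<open>N > 0\<close> by (intro \<delta>(2)) auto
      then show ?thesis
        by (simp add: x_def)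
    qed
    \<comment> \<open>The two ways around a cell have the same sum: both go along a diagonal of a ball.\<close>
    have cell: "I (x m n) (x m (Suc n)) + V m (Suc n) = V m n + I (x (Suc m) n) (x (Suc m) (Suc n))"
      if mn: "m < N" "n < N" for m n
    proof -
      have "(real m / real N, real n / real N) \<in> ?Q"
        using mn by auto
      then have ball: "ball (x m n) e \<subseteq> U"
        using e(2) unfolding x_def by blast
      show ?thesis
        unfolding V_def using additive_on_ballsD[OF I ball] near[OF mn] by (metis insertCI)
    qed
    \<comment> \<open>The homotopy keeps the end points fixed, so the outer sides of the grid are constant.\<close>
    have V_ends: "V m 0 = 0 \<and> V m N = 0" if "m < N" for m
    proof -
      have pt: "x k 0 = p 0 \<and> x k N = p 1" if "k \<le> N" for k
        using that \<open>N > 0\<close> by (auto simp: x_def intro!: ends)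
      have diag: "I y y = 0" if "ball y e \<subseteq> U" for y
        using additive_on_ballsD[OF I that, of y y y] e(1) by simp
      have "h (0, 0) \<in> h ` ?Q" "h (0, 1) \<in> h ` ?Q"
        by auto
      then have "ball (h (0, 0)) e \<subseteq> U" "ball (h (0, 1)) e \<subseteq> U"
        using e(2) by blast+
      then have "ball (p 0) e \<subseteq> U" "ball (p 1) e \<subseteq> U"
        using h0 by simp_all
      then show ?thesis
        using that pt[of m] pt[of "Suc m"] diag by (simp add: V_def)
    qed
    have step: "S m = S (Suc m)" if m: "m < N" for m
    proof -
      have "S m - S (Suc m) = (\<Sum>n<N. V m n - V m (Suc n))"
        unfolding S_def sum_subtractf[symmetric] using cell[OF m] by (intro sum.cong) (auto simp: algebra_simps)
      also have "\<dots> = V m 0 - V m N"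
        by (rule sum_lessThan_telescope')
      finally show ?thesis
        using V_ends[OF m] by simp
    qed
    have "S 0 = S m" if "m \<le> N" for m
      using that by (induction m) (auto simp: step)
    then have "S 0 = S N"
      by simp
    moreover have "S 0 = chain_sum I p N"
      unfolding S_def chain_sum_def x_def by (intro sum.cong) (auto simp: h0)
    moreover have "S N = chain_sum I q N"
      unfolding S_def chain_sum_def x_def using \<open>N > 0\<close> by (intro sum.cong) (auto simp: h1)
    ultimately show ?thesis
      by simp
  qed
  moreover have "\<forall>\<^sub>F N in sequentially. 2 / \<delta> < real N"
    using filterlim_real_sequentially by (simp add: filterlim_at_top_dense)
  ultimately show ?thesis
    by (auto elim: eventually_mono)
qed

lemma chain_sum_joinpaths:
  assumes "pathfinish g1 = pathstart g2" "N > 0"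
  shows "chain_sum I (g1 +++ g2) (2 * N) = chain_sum I g1 N + chain_sum I g2 N"
proof -
  have split: "(\<Sum>n<N + M. f n) = (\<Sum>n<N. f n) + (\<Sum>n<M. f (N + n))" for f :: "nat \<Rightarrow> real" and M
    by (induction M) auto
  have first: "(g1 +++ g2) (real n / real (2 * N)) = g1 (real n / real N)" if "n \<le> N" for n
    using that assms(2) by (auto simp: joinpaths_def field_simps)
  have second: "(g1 +++ g2) (real (N + n) / real (2 * N)) = g2 (real n / real N)" for n
  proof (cases "n = 0")
    case True
    then show ?thesis
      using first[of N] assms by (simp add: pathfinish_def pathstart_def)
  next
    case False
    then have "\<not> real (N + n) / real (2 * N) \<le> 1 / 2" "2 * (real (N + n) / real (2 * N)) - 1 = real n / real N"
      using assms(2) by (auto simp: field_simps)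
    then show ?thesis
      by (simp only: joinpaths_def if_False)
  qed
  have "chain_sum I (g1 +++ g2) (2 * N) =
      (\<Sum>n<N. I ((g1 +++ g2) (real n / real (2 * N))) ((g1 +++ g2) (real (Suc n) / real (2 * N)))) +
      (\<Sum>n<N. I ((g1 +++ g2) (real (N + n) / real (2 * N))) ((g1 +++ g2) (real (N + Suc n) / real (2 * N))))"
    unfolding chain_sum_def mult_2 split by simp
  also have "\<dots> = chain_sum I g1 N + chain_sum I g2 N"
    unfolding chain_sum_def
    by (intro arg_cong2[of _ _ _ _ "(+)"] sum.cong refl)
      (simp_all only: first second lessThan_iff less_imp_le_nat Suc_leI)
  finally show ?thesis .
qed

lemma chain_sum_linepath:
  fixes U :: "'a::real_normed_vector set"
  assumes I: "additive_on_balls U I" and ball: "ball x e \<subseteq> U" and y: "y \<in> ball x e" and N: "N > 0"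
  shows "chain_sum I (linepath x y) N = I x y"
proof -
  let ?p = "\<lambda>n. linepath x y (real n / real N)"
  have x: "x \<in> ball x e"
    using y zero_le_dist[of x y] by (simp del: zero_le_dist)
  have in_ball: "?p n \<in> ball x e" if "n \<le> N" for n
  proof -
    have "?p n \<in> closed_segment x y"
      using that N by (intro linepath_in_path) auto
    then show ?thesis
      using closed_segment_subset[OF x y convex_ball] by blast
  qed
  have "(\<Sum>n<k. I (?p n) (?p (Suc n))) = I (?p 0) (?p k)" if "k \<le> N" for k
    using that
  proof (induction k)
    case 0
    show ?case
      using additive_on_ballsD[OF I ball x x x] by (simp add: linepath_0')
  next
    case (Suc k)
    then show ?case
      using additive_on_ballsD[OF I ball in_ball in_ball in_ball, of 0 k "Suc k"] by simp
  qed
  from this[of N] N show ?thesis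
    by (simp add: chain_sum_def linepath_0' linepath_1')
qed

text \<open>
  In a simply connected set the sum along a path from a base point depends, for fine subdivisions, only
  on its end point. This end point function \<open>F\<close> is the primitive of \<open>I\<close>: extending the path by a short
  segment from \<open>x\<close> to \<open>y\<close> adds \<open>I x y\<close>.
\<close>

lemma additive_on_balls_imp_global_difference:
  fixes U :: "'a::real_normed_vector set"
  assumes I: "additive_on_balls U I" and U: "open U" "simply_connected U"
  obtains F where "\<And>x e y. ball x e \<subseteq> U \<Longrightarrow> y \<in> ball x e \<Longrightarrow> I x y = F y - F x"
proof (cases "U = {}")
  case True
  show ?thesis
  proof (rule that[of "\<lambda>_. 0"])
    fix x e and y :: 'a
    assume "ball x e \<subseteq> U" "y \<in> ball x e"
    then show "I x y = 0 - 0"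
      using True by blast
  qed
next
  case False
  then obtain a where a: "a \<in> U"
    by blast
  have "path_connected U"
    using U by (simp add: simply_connected_imp_path_connected)
  then have "\<forall>x\<in>U. \<exists>g. path g \<and> path_image g \<subseteq> U \<and> pathstart g = a \<and> pathfinish g = x"
    using a unfolding path_connected_def by blast
  then obtain \<gamma> where \<gamma>: "\<And>x. x \<in> U \<Longrightarrow> path (\<gamma> x)" "\<And>x. x \<in> U \<Longrightarrow> path_image (\<gamma> x) \<subseteq> U"
      "\<And>x. x \<in> U \<Longrightarrow> pathstart (\<gamma> x) = a" "\<And>x. x \<in> U \<Longrightarrow> pathfinish (\<gamma> x) = x"
    by metis
  \<comment> \<open>Concatenation with a segment halves the parameter speed, whence the factor 2 on the left.\<close>
  have doubling: "\<forall>\<^sub>F N in sequentially. chain_sum I (\<gamma> y) (2 * N) = chain_sum I (\<gamma> x) N + I x y"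
    if ball: "ball x e \<subseteq> U" and y: "y \<in> ball x e" for x e y
  proof -
    have x: "x \<in> ball x e"
      using y zero_le_dist[of x y] by (simp del: zero_le_dist)
    have seg: "path_image (linepath x y) \<subseteq> U"
      using closed_segment_subset[OF x y convex_ball] ball by simp
    have xyU: "x \<in> U" "y \<in> U"
      using x y ball by auto
    have "homotopic_paths U (\<gamma> x +++ linepath x y) (\<gamma> y)"
      using U(2)[unfolded simply_connected_eq_homotopic_paths] \<gamma> xyU seg
      by (simp add: path_image_join)
    then have "\<forall>\<^sub>F N in sequentially. chain_sum I (\<gamma> x +++ linepath x y) N = chain_sum I (\<gamma> y) N"
      by (rule chain_sum_homotopic_paths[OF I U(1)])
    then have "\<forall>\<^sub>F N in sequentially. chain_sum I (\<gamma> x +++ linepath x y) (2 * N) = chain_sum I (\<gamma> y) (2 * N)"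
      by (rule eventually_compose_filterlim) (auto intro!: filterlim_subseq simp: strict_mono_def)
    moreover have "\<forall>\<^sub>F N in sequentially. 0 < (N::nat)"
      by (rule eventually_gt_at_top)
    ultimately show ?thesis
    proof eventually_elim
      case (elim N)
      then show ?case
        using chain_sum_joinpaths[of "\<gamma> x" "linepath x y" N I] chain_sum_linepath[OF I ball y, of N] \<gamma>(4) xyU
        by simp
    qed
  qed
  have powers: "filterlim (\<lambda>m. 2 ^ m :: nat) sequentially sequentially"
    by (auto intro!: filterlim_subseq simp: strict_mono_def)
  \<comment> \<open>The case \<open>y = x\<close> of \<open>doubling\<close> makes the sums over \<open>2 ^ m\<close> steps eventually constant. Powers of 2
    are used because \<open>doubling\<close> compares only \<open>N\<close> with \<open>2 * N\<close> steps.\<close>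
  have "\<exists>L. \<forall>\<^sub>F m in sequentially. chain_sum I (\<gamma> x) (2 ^ m) = L" if "x \<in> U" for x
  proof -
    obtain e where e: "e > 0" "ball x e \<subseteq> U"
      by (rule openE[OF U(1) \<open>x \<in> U\<close>])
    have "I x x = 0"
      using additive_on_ballsD[OF I e(2), of x x x] e(1) by simp
    then have "\<forall>\<^sub>F m in sequentially. chain_sum I (\<gamma> x) (2 * 2 ^ m) = chain_sum I (\<gamma> x) (2 ^ m)"
      using eventually_compose_filterlim[OF doubling[OF e(2), of x] powers] e(1)
      by (simp del: power_Suc)
    then obtain m0 where m0: "\<And>m. m \<ge> m0 \<Longrightarrow> chain_sum I (\<gamma> x) (2 * 2 ^ m) = chain_sum I (\<gamma> x) (2 ^ m)"
      unfolding eventually_sequentially by blast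
    have "chain_sum I (\<gamma> x) (2 ^ m) = chain_sum I (\<gamma> x) (2 ^ m0)" if "m \<ge> m0" for m
      using that by (induction m rule: dec_induct) (auto simp: m0)
    then show ?thesis
      unfolding eventually_sequentially by blast
  qed
  then obtain F where F: "\<And>x. x \<in> U \<Longrightarrow> \<forall>\<^sub>F m in sequentially. chain_sum I (\<gamma> x) (2 ^ m) = F x"
    by metis
  show ?thesis
  proof (rule that[of F])
    fix x e y
    assume ball: "ball x e \<subseteq> U" and y: "y \<in> ball x e"
    have "x \<in> U" "y \<in> U"
      using y ball zero_le_dist[of x y] by (auto simp del: zero_le_dist)
    have "\<forall>\<^sub>F m in sequentially. chain_sum I (\<gamma> y) (2 ^ Suc m) = F y"
      using F[OF \<open>y \<in> U\<close>] by (subst eventually_sequentially_Suc)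
    moreover have "\<forall>\<^sub>F m in sequentially. chain_sum I (\<gamma> y) (2 * 2 ^ m) = chain_sum I (\<gamma> x) (2 ^ m) + I x y"
      by (rule eventually_compose_filterlim[OF doubling[OF ball y] powers])
    ultimately have "\<forall>\<^sub>F m in sequentially. I x y = F y - F x"
      using F[OF \<open>x \<in> U\<close>] by eventually_elim simp
    then show "I x y = F y - F x"
      by simp
  qed
qed


section \<open>Potentials of closed vector fields\<close>

definition work :: "('a::real_inner \<Rightarrow> 'a) \<Rightarrow> 'a \<Rightarrow> 'a \<Rightarrow> real"
where
  "work K a b = integral {0..1} (\<lambda>t. K (a + t *\<^sub>R (b - a)) \<bullet> (b - a))"

lemma segment_in_convex:
  assumes "convex S" "a \<in> S" "b \<in> S" "t \<in> {0..1::real}"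
  shows "a + t *\<^sub>R (b - a) \<in> S"
proof -
  have "a + t *\<^sub>R (b - a) = (1 - t) *\<^sub>R a + t *\<^sub>R b"
    by (simp add: algebra_simps)
  then show ?thesis
    using convexD_alt[OF assms(1-3)] assms(4) by simp
qed

lemma work_eq_potential_difference:
  assumes "convex S" and P: "\<And>x. x \<in> S \<Longrightarrow> (P has_derivative (\<lambda>v. K x \<bullet> v)) (at x)"
    and "a \<in> S" "b \<in> S"
  shows "work K a b = P b - P a"
proof -
  have "((\<lambda>t. P (a + t *\<^sub>R (b - a))) has_vector_derivative K (a + t *\<^sub>R (b - a)) \<bullet> (b - a))
      (at t within {0..1})" if "t \<in> {0..1}" for t
  proof -
    have "((\<lambda>t. P (a + t *\<^sub>R (b - a))) has_derivative
        (\<lambda>s. K (a + t *\<^sub>R (b - a)) \<bullet> (s *\<^sub>R (b - a)))) (at t within {0..1})"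
      by (rule has_derivative_compose[of "\<lambda>t. a + t *\<^sub>R (b - a)" "\<lambda>s. s *\<^sub>R (b - a)" _ _ P, OF _ P])
        (auto intro!: derivative_eq_intros segment_in_convex[OF assms(1,3,4) that])
    then show ?thesis
      by (simp add: has_vector_derivative_def)
  qed
  from fundamental_theorem_of_calculus[OF _ this] show ?thesis
    unfolding work_def by (simp add: integral_unique)
qed

text \<open>
  The Poincare lemma in a convex set: the work from a fixed point is a potential of a closed field. The
  symmetry of \<open>K'\<close> turns the integrand of the derivative into a total derivative in \<open>t\<close>.
\<close>

lemma work_has_derivative:
  fixes K :: "'a::euclidean_space \<Rightarrow> 'a"
  assumes S: "open S" "convex S" and a: "a \<in> S" and y: "y \<in> S"
    and K': "\<And>x. x \<in> S \<Longrightarrow> (K has_derivative K' x) (at x)"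
    and cont: "\<And>v. continuous_on S (\<lambda>x. K' x v)"
    and sym: "\<And>x v w. x \<in> S \<Longrightarrow> K' x v \<bullet> w = K' x w \<bullet> v"
  shows "(work K a has_derivative (\<lambda>v. K y \<bullet> v)) (at y)"
proof -
  let ?z = "\<lambda>x t. a + t *\<^sub>R (x - a)"
  let ?D = "\<lambda>x t v. K' (?z x t) (t *\<^sub>R v) \<bullet> (x - a) + K (?z x t) \<bullet> v"
  have z: "?z x t \<in> S" if "x \<in> S" "t \<in> cbox 0 1" for x t
    using segment_in_convex[OF S(2) a that(1)] that(2) by simp
  have lin: "bounded_linear (K' x)" if "x \<in> S" for x
    using K'[OF that] by (rule has_derivative_bounded_linear)
  have K_cont: "continuous_on S K"
    using K' has_derivative_continuous by (blast intro: continuous_at_imp_continuous_on)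
  have D: "((\<lambda>x. K (?z x t) \<bullet> (x - a)) has_derivative ?D x t) (at x)" if "x \<in> S" "t \<in> cbox 0 1" for x t
  proof -
    have "((\<lambda>x. K (?z x t)) has_derivative (\<lambda>v. K' (?z x t) (t *\<^sub>R v))) (at x)"
      by (rule has_derivative_compose[of "\<lambda>x. ?z x t" "\<lambda>v. t *\<^sub>R v" _ _ K, OF _ K'])
        (auto intro!: derivative_eq_intros z that)
    moreover have "((\<lambda>x. x - a) has_derivative (\<lambda>v. v)) (at x)"
      by (auto intro!: derivative_eq_intros)
    ultimately show ?thesis
      using has_derivative_inner by (fastforce simp: add.commute)
  qed
  define G where "G x t = Blinfun (?D x t)" for x t
  have G: "blinfun_apply (G x t) = ?D x t" if "x \<in> S" "t \<in> cbox 0 1" for x t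
    unfolding G_def by (rule bounded_linear_Blinfun_apply[OF has_derivative_bounded_linear[OF D[OF that]]])
  have z_cont: "continuous_on (S \<times> cbox 0 1) (\<lambda>p. ?z (fst p) (snd p))"
    by (intro continuous_intros)
  have z_in: "(\<lambda>p. ?z (fst p) (snd p)) ` (S \<times> cbox 0 1) \<subseteq> S"
    by (rule image_subsetI, rule z) (simp_all add: mem_Times_iff)
  have G_cont: "continuous_on (S \<times> cbox 0 1) (\<lambda>(x, t). G x t)"
  proof (rule continuous_on_blinfun_componentwise)
    fix v :: 'a
    have "continuous_on (S \<times> cbox 0 1) (\<lambda>p. K' (?z (fst p) (snd p)) v)"
         "continuous_on (S \<times> cbox 0 1) (\<lambda>p. K (?z (fst p) (snd p)))"
      by (rule continuous_on_compose2[OF cont z_cont z_in] continuous_on_compose2[OF K_cont z_cont z_in])+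
    then have "continuous_on (S \<times> cbox 0 1) (\<lambda>p. snd p *\<^sub>R K' (?z (fst p) (snd p)) v \<bullet> (fst p - a)
        + K (?z (fst p) (snd p)) \<bullet> v)"
      by (intro continuous_intros)
    then show "continuous_on (S \<times> cbox 0 1) (\<lambda>p. blinfun_apply (case p of (x, t) \<Rightarrow> G x t) v)"
      by (rule continuous_on_eq)
        (auto simp: G linear_scale[OF bounded_linear.linear[OF lin]] z[simplified])
  qed
  have "((\<lambda>x. integral (cbox 0 1) (\<lambda>t. K (?z x t) \<bullet> (x - a))) has_derivative
      blinfun_apply (integral (cbox 0 1) (G y))) (at y within S)"
  proof (rule leibniz_rule[OF _ _ G_cont y S(2)])
    show "((\<lambda>x. K (?z x t) \<bullet> (x - a)) has_derivative blinfun_apply (G x t)) (at x within S)"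
      if "x \<in> S" "t \<in> cbox 0 1" for x t
      using has_derivative_at_withinI[OF D[OF that]] by (simp add: G[OF that])
    show "(\<lambda>t. K (?z x t) \<bullet> (x - a)) integrable_on cbox 0 1" if "x \<in> S" for x
      using z[OF that] by (intro integrable_continuous continuous_on_compose2[OF K_cont] continuous_intros) auto
  qed
  moreover have "blinfun_apply (integral (cbox 0 1) (G y)) v = K y \<bullet> v" for v
  proof -
    have "G y integrable_on cbox 0 1"
      by (intro integrable_continuous continuous_on_compose2[OF G_cont, of _ "\<lambda>t. (y, t)", simplified])
        (auto intro!: continuous_intros simp: y)
    then have "blinfun_apply (integral (cbox 0 1) (G y)) v = integral (cbox 0 1) (\<lambda>t. ?D y t v)"
      by (subst blinfun_apply_integral) (auto intro!: integral_cong simp: G y)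
    also have "\<dots> = 1 *\<^sub>R (K (?z y 1) \<bullet> v) - 0 *\<^sub>R (K (?z y 0) \<bullet> v)"
    proof -
      \<comment> \<open>By the symmetry of \<open>K'\<close> the integrand is the derivative of \<open>t *\<^sub>R (K (z t) \<bullet> v)\<close>.\<close>
      have "((\<lambda>t. t *\<^sub>R (K (?z y t) \<bullet> v)) has_vector_derivative ?D y t v) (at t within {0..1})"
        if t: "t \<in> {0..1}" for t
      proof -
        have zt: "?z y t \<in> S"
          using z[OF y] t by simp
        have "((\<lambda>t. K (?z y t)) has_derivative (\<lambda>s. K' (?z y t) (s *\<^sub>R (y - a)))) (at t within {0..1})"
          by (rule has_derivative_compose[of "?z y" "\<lambda>s. s *\<^sub>R (y - a)" _ _ K, OF _ K'])
            (auto intro!: derivative_eq_intros zt)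
        then have "((\<lambda>t. t *\<^sub>R (K (?z y t) \<bullet> v)) has_derivative
            (\<lambda>s. t *\<^sub>R (K' (?z y t) (s *\<^sub>R (y - a)) \<bullet> v) + s *\<^sub>R (K (?z y t) \<bullet> v))) (at t within {0..1})"
          by (intro has_derivative_scaleR has_derivative_ident has_derivative_inner_left)
        moreover have "t *\<^sub>R (K' (?z y t) (s *\<^sub>R (y - a)) \<bullet> v) + s *\<^sub>R (K (?z y t) \<bullet> v) = s *\<^sub>R ?D y t v" for s
          unfolding linear_scale[OF bounded_linear.linear[OF lin[OF zt]]] inner_scaleR_left
            sym[OF zt, of "y - a" v] by (simp only: real_scaleR_def distrib_left mult.left_commute)
        ultimately show ?thesis
          by (simp add: has_vector_derivative_def)
      qed
      from fundamental_theorem_of_calculus[OF zero_le_one this] show ?thesis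
        unfolding box_real by (rule integral_unique)
    qed
    finally show ?thesis
      by simp
  qed
  then have "blinfun_apply (integral (cbox 0 1) (G y)) = (\<lambda>v. K y \<bullet> v)"
    by blast
  ultimately have "(work K a has_derivative (\<lambda>v. K y \<bullet> v)) (at y within S)"
    by (simp add: work_def[abs_def])
  then show ?thesis
    using at_within_open[OF y S(1)] by simp
qed

text \<open>
  On balls, work is a difference of values of a potential, hence additive; the differences then glue to
  a global potential.
\<close>

lemma closed_field_has_potential:
  fixes K :: "'a::euclidean_space \<Rightarrow> 'a"
  assumes U: "open U" "simply_connected U"
    and K': "\<And>x. x \<in> U \<Longrightarrow> (K has_derivative K' x) (at x)"
    and cont: "\<And>v. continuous_on U (\<lambda>x. K' x v)"
    and sym: "\<And>x v w. x \<in> U \<Longrightarrow> K' x v \<bullet> w = K' x w \<bullet> v"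
  obtains F where "\<And>x. x \<in> U \<Longrightarrow> (F has_derivative (\<lambda>v. K x \<bullet> v)) (at x)"
proof -
  have local: "(work K a has_derivative (\<lambda>v. K y \<bullet> v)) (at y)"
    if "ball x e \<subseteq> U" "a \<in> ball x e" "y \<in> ball x e" for x e a y
    using that by (intro work_has_derivative[of "ball x e", where K' = K'] K' sym continuous_on_subset[OF cont]) auto
  have "additive_on_balls U (work K)"
    unfolding additive_on_balls_def
  proof (intro allI impI ballI)
    fix x e a b c
    assume ball: "ball x e \<subseteq> U" and abc: "a \<in> ball x e" "b \<in> ball x e" "c \<in> ball x e"
    have diff: "work K u v = work K a v - work K a u" if "u \<in> ball x e" "v \<in> ball x e" for u v
      using work_eq_potential_difference[OF convex_ball local[OF ball abc(1)] that] .
    show "work K a b + work K b c = work K a c"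
      using diff[OF abc(2,3)] by simp
  qed
  then obtain F where F: "\<And>x e y. ball x e \<subseteq> U \<Longrightarrow> y \<in> ball x e \<Longrightarrow> work K x y = F y - F x"
    using additive_on_balls_imp_global_difference U by metis
  show thesis
  proof (rule that[of F])
    fix x
    assume x: "x \<in> U"
    obtain e where e: "e > 0" "ball x e \<subseteq> U"
      by (rule openE[OF U(1) x])
    have "((\<lambda>y. work K x y + F x) has_derivative (\<lambda>v. K x \<bullet> v)) (at x)"
      using local[OF e(2), of x x] e(1) by (auto intro: has_derivative_add_const)
    then show "(F has_derivative (\<lambda>v. K x \<bullet> v)) (at x)"
      by (rule has_derivative_transform_within_open[of _ _ _ _ "ball x e"]) (use e F in auto)
  qed
qed


section \<open>Smooth maps and partial derivatives\<close>

lemma smooth_on_imp_differentiable: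
  assumes "smooth_on S g" "x \<in> S"
  shows "g differentiable (at x)"
proof -
  have "C_k_on (Suc 0) S g"
    using assms(1) unfolding smooth_on_def by blast
  then show ?thesis
    using assms(2) by simp
qed

lemma smooth_on_imp_continuous_on:
  assumes "smooth_on S g"
  shows "continuous_on S g"
proof -
  have "C_k_on 0 S g"
    using assms unfolding smooth_on_def by blast
  then show ?thesis
    by simp
qed

lemma has_derivative_imp_partial:
  assumes "(g has_derivative D) (at f)"
  shows "has_partial_derivative g (D (axis k 1)) k f"
proof -
  have "((\<lambda>s. g (f + s *\<^sub>R axis k 1)) has_derivative (\<lambda>s. D (s *\<^sub>R axis k 1))) (at 0)"
    using assms
    by (intro has_derivative_compose[of "\<lambda>s. f + s *\<^sub>R axis k 1" "\<lambda>s. s *\<^sub>R axis k 1" _ _ g D])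
      (auto intro!: derivative_eq_intros)
  moreover have "D (s *\<^sub>R axis k 1) = s *\<^sub>R D (axis k 1)" for s
    using linear_scale[OF has_derivative_linear[OF assms]] by blast
  ultimately show ?thesis
    unfolding has_partial_derivative_def has_field_derivative_def by (simp add: mult_commute_abs)
qed

lemma has_derivative_from_partials:
  assumes "g differentiable (at f)" "\<And>k. has_partial_derivative g (p k) k f"
  shows "(g has_derivative (\<lambda>v. \<Sum>k\<in>UNIV. v $ k * p k)) (at f)"
proof -
  obtain D where D: "(g has_derivative D) (at f)"
    using assms(1) unfolding differentiable_def by blast
  have p: "D (axis k 1) = p k" for k
    using has_derivative_imp_partial[OF D, of k] assms(2)[of k]
    unfolding has_partial_derivative_def by (rule DERIV_unique)
  have "D v = (\<Sum>k\<in>UNIV. v $ k * p k)" for v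
  proof -
    have "D v = D (\<Sum>k\<in>UNIV. (v $ k) *\<^sub>R axis k 1)"
      using basis_expansion[of v] by (simp add: scalar_mult_eq_scaleR)
    also have "\<dots> = (\<Sum>k\<in>UNIV. v $ k * p k)"
      using has_derivative_linear[OF D] by (simp add: linear_sum linear_scale p)
    finally show ?thesis .
  qed
  then have "D = (\<lambda>v. \<Sum>k\<in>UNIV. v $ k * p k)"
    by (rule ext)
  then show ?thesis
    using D by simp
qed

lemma has_vector_derivative_frechet:
  assumes "c differentiable (at s)"
  shows "(c has_vector_derivative frechet_derivative c (at s) 1) (at s)"
proof -
  have D: "(c has_derivative frechet_derivative c (at s)) (at s)"
    using assms by (simp add: frechet_derivative_works)
  have "frechet_derivative c (at s) r = r *\<^sub>R frechet_derivative c (at s) 1" for r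
    using linear_scale[OF has_derivative_linear[OF D], of r 1] by simp
  then have "frechet_derivative c (at s) = (\<lambda>r. r *\<^sub>R frechet_derivative c (at s) 1)"
    by (rule ext)
  then show ?thesis
    using D unfolding has_vector_derivative_def by simp
qed

text \<open>
  The product rule for \<open>K (c s) \<bullet> c' s\<close>, which is the first derivative on all of the open set \<open>I\<close>.
\<close>

lemma second_derivative_of_potential_along_curve:
  fixes K :: "real ^ 'n \<Rightarrow> real ^ 'n"
  assumes F: "\<And>x. x \<in> U \<Longrightarrow> (F has_derivative (\<lambda>v. K x \<bullet> v)) (at x)"
    and K': "\<And>x. x \<in> U \<Longrightarrow> (K has_derivative K' x) (at x)"
    and I: "open I" "t \<in> I" and c: "smooth_on I c" "c ` I \<subseteq> U"
  defines "v \<equiv> \<chi> i. deriv (\<lambda>s. c s $ i) t"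
  shows "has_second_derivative (\<lambda>s. F (c s))
    (K' (c t) v \<bullet> v + (\<Sum>i\<in>UNIV. K (c t) $ i * deriv (deriv (\<lambda>s. c s $ i)) t)) t"
proof -
  define c' where "c' s = frechet_derivative c (at s) 1" for s
  have c': "(c has_vector_derivative c' s) (at s)" if "s \<in> I" for s
    unfolding c'_def using smooth_on_imp_differentiable[OF c(1) that] by (rule has_vector_derivative_frechet)
  have "C_k_on (Suc (Suc 0)) I c"
    using c(1) unfolding smooth_on_def by blast
  then have "c' differentiable (at t)"
    using I(2) unfolding c'_def by simp
  then obtain c'' where c'': "(c' has_vector_derivative c'') (at t)"
    using has_vector_derivative_frechet by blast
  have comp: "((\<lambda>s. c s $ i) has_real_derivative c' s $ i) (at s)" if "s \<in> I" for i s
    unfolding has_real_derivative_iff_has_vector_derivative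
    by (rule bounded_linear.has_vector_derivative[OF bounded_linear_vec_nth c'[OF that]])
  have comp': "((\<lambda>s. c' s $ i) has_real_derivative c'' $ i) (at t)" for i
    unfolding has_real_derivative_iff_has_vector_derivative
    by (rule bounded_linear.has_vector_derivative[OF bounded_linear_vec_nth c''])
  have v: "v = c' t"
    by (simp add: v_def vec_eq_iff DERIV_imp_deriv[OF comp[OF I(2)]])
  have second: "deriv (deriv (\<lambda>s. c s $ i)) t = c'' $ i" for i
  proof (rule DERIV_imp_deriv)
    show "(deriv (\<lambda>s. c s $ i) has_real_derivative c'' $ i) (at t)"
      by (rule has_field_derivative_transform_within_open[OF comp' I])
        (simp add: DERIV_imp_deriv[OF comp])
  qed
  have Fc: "((\<lambda>s. F (c s)) has_real_derivative K (c s) \<bullet> c' s) (at s)" if s: "s \<in> I" for s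
  proof -
    have "c s \<in> U"
      using c(2) s by blast
    from has_derivative_compose[of c "\<lambda>r. r *\<^sub>R c' s" s UNIV F, OF _ F[OF this]]
    have "((\<lambda>s. F (c s)) has_derivative (\<lambda>r. K (c s) \<bullet> (r *\<^sub>R c' s))) (at s)"
      using c'[OF s] by (simp add: has_vector_derivative_def)
    then show ?thesis
      by (simp add: has_field_derivative_def mult_commute_abs)
  qed
  have "c t \<in> U"
    using c(2) I(2) by blast
  from has_derivative_compose[of c "\<lambda>r. r *\<^sub>R c' t" t UNIV K, OF _ K'[OF this]]
  have "((\<lambda>s. K (c s)) has_derivative (\<lambda>r. K' (c t) (r *\<^sub>R c' t))) (at t)"
    using c'[OF I(2)] by (simp add: has_vector_derivative_def)
  from has_derivative_inner[OF this c''[unfolded has_vector_derivative_def]]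
  have "((\<lambda>s. K (c s) \<bullet> c' s) has_derivative (\<lambda>r. K (c t) \<bullet> (r *\<^sub>R c'') + K' (c t) (r *\<^sub>R c' t) \<bullet> c' t)) (at t)" .
  moreover have "K (c t) \<bullet> (r *\<^sub>R c'') + K' (c t) (r *\<^sub>R c' t) \<bullet> c' t = (K' (c t) v \<bullet> v + K (c t) \<bullet> c'') * r" for r
    unfolding v linear_scale[OF has_derivative_linear[OF K'[OF \<open>c t \<in> U\<close>]]] by (simp add: algebra_simps)
  ultimately have "((\<lambda>s. K (c s) \<bullet> c' s) has_real_derivative K' (c t) v \<bullet> v + K (c t) \<bullet> c'') (at t)"
    unfolding has_field_derivative_def by simp
  then have "(deriv (\<lambda>s. F (c s)) has_real_derivative K' (c t) v \<bullet> v + K (c t) \<bullet> c'') (at t)"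
    by (rule has_field_derivative_transform_within_open[OF _ I]) (simp add: DERIV_imp_deriv[OF Fc])
  moreover have "\<forall>\<^sub>F s in nhds t. (\<lambda>s. F (c s)) differentiable (at s)"
    using eventually_nhds_in_open[OF I]
    by (rule eventually_mono) (use Fc real_differentiable_def in blast)
  ultimately show ?thesis
    by (simp add: has_second_derivative_def second inner_vec_def)
qed


section \<open>The geometry of a metrized triangle\<close>

definition cosine_from_lengths :: "('v \<Rightarrow> 'v \<Rightarrow> real) \<Rightarrow> 'v \<Rightarrow> 'v \<Rightarrow> 'v \<Rightarrow> real"
where
  "cosine_from_lengths l i j k = ((l i j)\<^sup>2 + (l i k)\<^sup>2 - (l j k)\<^sup>2) / (2 * l i j * l i k)"

lemma edge_length_commute: "edge_length d i j = edge_length d j i"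
  by (simp add: edge_length_def add.commute)

lemma triangles_distinct:
  assumes "{i, j, k} \<in> triangles T"
  shows "i \<noteq> j" "i \<noteq> k" "j \<noteq> k"
  using assms by (auto simp: triangles_def card_insert_if split: if_splits)

text \<open>
  Nondegeneracy of the triangle keeps the cosine away from 1 and -1, where \<open>arccos\<close> is not
  differentiable and the denominator of the height vanishes; the angle thereby becomes an explicit function of the lengths.
\<close>

lemma triangle_in_met:
  assumes d: "d \<in> met T" and t: "{i, j, k} \<in> triangles T"
  defines "x \<equiv> cosine_from_lengths (edge_length d) i j k"
  shows "edge_length d i j > 0"
    and "\<bar>x\<bar> < 1"
    and "triangle_angle (edge_length d) i {i, j, k} = arccos x"
    and "center_height d i j k = (d i k - d i j * x) / sqrt (1 - x\<^sup>2)"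
proof -
  let ?l = "edge_length d"
  note dist = triangles_distinct[OF t]
  have "{i, j, k} \<in> T"
    using t by (simp add: triangles_def)
  then obtain p where p: "realizes_simplex ?l {i, j, k} p"
    using d by (auto simp: met_def piecewise_flat_def)
  then have len: "dist (p i) (p j) = ?l i j" "dist (p i) (p k) = ?l i k" "dist (p j) (p k) = ?l j k"
    using dist by (auto simp: realizes_simplex_def)
  have inj: "p i \<noteq> p j" "p i \<noteq> p k" "p j \<noteq> p k"
    using p dist by (auto simp: realizes_simplex_def inj_on_def)
  then show "?l i j > 0"
    using len by (metis zero_less_dist_iff)
  have "triangle_angle ?l i {i, j, k} = vector_angle (p j - p i) (p k - p i)"
    by (rule triangle_angle_eq[OF dist p])
  also have "\<dots> = arccos x"
    by (simp add: vector_angle_law_of_cosines len x_def cosine_from_lengths_def)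
  finally show angle: "triangle_angle ?l i {i, j, k} = arccos x" .
  have "\<not> collinear {p j, p i, p k}"
    using p inj by (auto simp: realizes_simplex_def collinear_3_eq_affine_dependent insert_commute)
  then have "\<bar>(p j - p i) \<bullet> (p k - p i)\<bar> \<noteq> norm (p j - p i) * norm (p k - p i)"
    by (simp add: norm_cauchy_schwarz_equal collinear_3)
  then have "\<bar>(p j - p i) \<bullet> (p k - p i)\<bar> < ?l i j * ?l i k"
    using Cauchy_Schwarz_ineq2[of "p j - p i" "p k - p i"] len
    by (simp add: dist_norm norm_minus_commute)
  moreover have "x = (p j - p i) \<bullet> (p k - p i) / (?l i j * ?l i k)"
    unfolding x_def cosine_from_lengths_def len[symmetric]
    by (simp add: dot_norm_neg dist_norm norm_minus_commute)
  moreover have "0 < ?l i j * ?l i k"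
    using inj len by (metis mult_pos_pos zero_less_dist_iff)
  ultimately show x: "\<bar>x\<bar> < 1"
    by (simp only: abs_divide abs_of_pos divide_less_eq_1_pos)
  then have "cos (arccos x) = x" "sin (arccos x) = sqrt (1 - x\<^sup>2)"
    by (simp_all add: cos_arccos_abs sin_arccos_abs)
  then show "center_height d i j k = (d i k - d i j * x) / sqrt (1 - x\<^sup>2)"
    by (simp add: center_height_def angle)
qed

text \<open>
  The metric condition \<open>d\<^sub>i\<^sub>j\<^sup>2 + d\<^sub>j\<^sub>k\<^sup>2 + d\<^sub>k\<^sub>i\<^sup>2 = d\<^sub>j\<^sub>i\<^sup>2 + d\<^sub>i\<^sub>k\<^sup>2 + d\<^sub>k\<^sub>j\<^sup>2\<close> linearizes the law of cosines. This is
  the only way in which the condition enters the proof: it yields both the symmetry of the heights and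
  the variation of the angles.
\<close>

lemma cosine_from_partial_lengths:
  assumes d: "d \<in> met T" and t: "{i, j, k} \<in> triangles T"
  shows "edge_length d i j * edge_length d i k * cosine_from_lengths (edge_length d) i j k
    = edge_length d i j * d j i - edge_length d j k * d j k + edge_length d i k * d i k"
proof -
  let ?l = "edge_length d"
  have t': "{i, k, j} \<in> triangles T"
    using t by (simp add: insert_commute)
  have "?l i j * ?l i k * cosine_from_lengths ?l i j k = ((?l i j)\<^sup>2 + (?l i k)\<^sup>2 - (?l j k)\<^sup>2) / 2"
    using triangle_in_met(1)[OF d t] triangle_in_met(1)[OF d t']
    by (simp add: cosine_from_lengths_def)
  moreover have "(d i j)\<^sup>2 + (d j k)\<^sup>2 + (d k i)\<^sup>2 = (d j i)\<^sup>2 + (d i k)\<^sup>2 + (d k j)\<^sup>2"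
    using d t unfolding met_def by blast
  ultimately show ?thesis
    by (simp add: edge_length_def power2_eq_square algebra_simps)
qed

text \<open>
  The height belongs to the edge and not to a directed edge; this is what makes the derivative of the
  curvature symmetric.
\<close>

lemma center_height_commute:
  assumes d: "d \<in> met T" and t: "{i, j, k} \<in> triangles T"
  shows "center_height d i j k = center_height d j i k"
proof -
  let ?l = "edge_length d"
  define a b c where "a = ?l j k" and "b = ?l i k" and "c = ?l i j"
  define x y where "x = cosine_from_lengths ?l i j k" and "y = cosine_from_lengths ?l j i k"
  have t': "{j, i, k} \<in> triangles T" "{j, k, i} \<in> triangles T" "{i, k, j} \<in> triangles T"
    using t by (simp_all add: insert_commute)
  have pos: "a > 0" "b > 0" "c > 0"
    using triangle_in_met(1)[OF d] t t' by (auto simp: a_def b_def c_def)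
  have bnd: "\<bar>x\<bar> < 1" "\<bar>y\<bar> < 1"
    using triangle_in_met(2)[OF d] t t' by (auto simp: x_def y_def)
  then have sq: "sqrt (1 - x\<^sup>2) > 0" "sqrt (1 - y\<^sup>2) > 0"
    by (simp_all add: abs_square_less_1)
  have x: "c * b * x = c * d j i - a * d j k + b * d i k"
    using cosine_from_partial_lengths[OF d t] by (simp add: a_def b_def c_def x_def)
  have y: "c * a * y = c * d i j - b * d i k + a * d j k"
    using cosine_from_partial_lengths[OF d t'(1)]
    by (simp add: a_def b_def c_def y_def edge_length_commute[of d j i])
  have xy: "2 * c * b * x = c\<^sup>2 + b\<^sup>2 - a\<^sup>2" "2 * c * a * y = c\<^sup>2 + a\<^sup>2 - b\<^sup>2"
    using pos by (simp_all add: x_def y_def cosine_from_lengths_def a_def b_def c_def edge_length_commute[of d j i])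
  \<comment> \<open>The law of sines, in the form that both sides are the altitude from the vertex \<open>k\<close>; it comes from
    the law of cosines because both sides are nonnegative.\<close>
  have "4 * c\<^sup>2 * (b\<^sup>2 * (1 - x\<^sup>2)) = 4 * c\<^sup>2 * b\<^sup>2 - (2 * c * b * x)\<^sup>2"
    by (simp add: power2_eq_square algebra_simps)
  also have "\<dots> = 4 * c\<^sup>2 * a\<^sup>2 - (2 * c * a * y)\<^sup>2"
    unfolding xy by (simp add: power2_eq_square algebra_simps)
  also have "\<dots> = 4 * c\<^sup>2 * (a\<^sup>2 * (1 - y\<^sup>2))"
    by (simp add: power2_eq_square algebra_simps)
  finally have "b\<^sup>2 * (1 - x\<^sup>2) = a\<^sup>2 * (1 - y\<^sup>2)"
    using pos(3) by simp
  then have "sqrt (b\<^sup>2 * (1 - x\<^sup>2)) = sqrt (a\<^sup>2 * (1 - y\<^sup>2))"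
    by (rule arg_cong)
  then have sines: "b * sqrt (1 - x\<^sup>2) = a * sqrt (1 - y\<^sup>2)"
    using pos by (simp add: real_sqrt_mult)
  have c: "c = d i j + d j i"
    by (simp add: c_def edge_length_def)
  \<comment> \<open>The numerators agree up to the same factor, now using the metric condition through \<open>x\<close>, \<open>y\<close>.\<close>
  have "c * (b * (d i k - d i j * x)) - c * (a * (d j k - d j i * y))
      = c * (b * d i k - a * d j k) - d i j * (c * b * x) + d j i * (c * a * y)"
    by (simp add: algebra_simps)
  also have "\<dots> = (c - (d i j + d j i)) * (b * d i k - a * d j k)"
    unfolding x y by (simp add: algebra_simps)
  finally have num: "b * (d i k - d i j * x) = a * (d j k - d j i * y)"
    using c pos(3) by simp
  have "(d i k - d i j * x) / sqrt (1 - x\<^sup>2) = (b * (d i k - d i j * x)) / (b * sqrt (1 - x\<^sup>2))"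
    using pos by simp
  also have "\<dots> = (d j k - d j i * y) / sqrt (1 - y\<^sup>2)"
    unfolding num sines using pos by simp
  finally show ?thesis
    using triangle_in_met(4)[OF d t] triangle_in_met(4)[OF d t'(1)] by (simp add: x_def y_def)
qed

lemma dual_length_commute:
  assumes "d \<in> met T"
  shows "dual_length T d i j = dual_length T d j i"
  unfolding dual_length_def
  using center_height_commute[OF assms, of i j] by (intro sum.cong) (auto simp: insert_commute)


section \<open>Conformal variation of angles\<close>

lemma triangle_edge:
  assumes "abstract_complex T" "{i, j, k} \<in> triangles T"
  shows "(i, j) \<in> directed_edges T"
proof -
  have down: "\<tau> \<in> T" if "\<sigma> \<in> T" "\<tau> \<subseteq> \<sigma>" "\<tau> \<noteq> {}" for \<sigma> \<tau>
    using assms(1) that by (simp add: abstract_complex_def)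
  have "{i, j, k} \<in> T"
    using assms(2) by (simp add: triangles_def)
  then have "{i, j} \<in> T"
    by (rule down) auto
  then show ?thesis
    using triangles_distinct[OF assms(2)] by (simp add: directed_edges_def)
qed

lemma directed_edges_sym: "(i, j) \<in> directed_edges T \<longleftrightarrow> (j, i) \<in> directed_edges T"
  by (auto simp: directed_edges_def insert_commute)

lemma conformal_structure_met:
  assumes "conformal_structure T U \<C>" "f \<in> U"
  shows "\<C> f \<in> met T"
  using assms by (simp add: conformal_structure_def)

lemma conformal_structureD:
  assumes "conformal_structure T U \<C>" "f \<in> U" "(i, j) \<in> directed_edges T"
  shows "smooth_on U (\<lambda>f. \<C> f i j)"
    and "has_partial_derivative (\<lambda>g. edge_length (\<C> g) i j) (\<C> f i j) i f"
    and "k \<noteq> i \<Longrightarrow> k \<noteq> j \<Longrightarrow> has_partial_derivative (\<lambda>g. \<C> g i j) 0 k f"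
proof -
  have *: "smooth_on U (\<lambda>f. \<C> f i j) \<and>
      (\<forall>f\<in>U. has_partial_derivative (\<lambda>g. edge_length (\<C> g) i j) (\<C> f i j) i f \<and>
        (\<forall>k. k \<noteq> i \<and> k \<noteq> j \<longrightarrow> has_partial_derivative (\<lambda>g. \<C> g i j) 0 k f))"
    using bspec[OF conjunct2[OF assms(1)[unfolded conformal_structure_def]] assms(3)]
    unfolding case_prod_conv .
  show "smooth_on U (\<lambda>f. \<C> f i j)"
    using * by (rule conjunct1)
  note ** = bspec[OF conjunct2[OF *] assms(2)]
  show "has_partial_derivative (\<lambda>g. edge_length (\<C> g) i j) (\<C> f i j) i f"
    using ** by (rule conjunct1)
  show "k \<noteq> i \<Longrightarrow> k \<noteq> j \<Longrightarrow> has_partial_derivative (\<lambda>g. \<C> g i j) 0 k f"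
    using ** by simp
qed

text \<open>
  The structure equations prescribe every partial derivative of a length, so the variation of the lengths
  involves the metric only, and not the derivatives of the individual \<open>d\<^sub>i\<^sub>j\<close>.
\<close>

lemma conformal_edge_length_has_derivative:
  assumes conf: "conformal_structure T U \<C>" and f: "f \<in> U" and e: "(i, j) \<in> directed_edges T"
  shows "((\<lambda>g. edge_length (\<C> g) i j) has_derivative (\<lambda>v. \<C> f i j * v $ i + \<C> f j i * v $ j)) (at f)"
proof -
  have e': "(j, i) \<in> directed_edges T" and "i \<noteq> j"
    using e by (auto simp: directed_edges_def insert_commute)
  note ij = conformal_structureD[OF conf f e] and ji = conformal_structureD[OF conf f e']
  let ?p = "\<lambda>k. if k = i then \<C> f i j else if k = j then \<C> f j i else 0"
  have "((\<lambda>g. edge_length (\<C> g) i j) has_derivative (\<lambda>v. \<Sum>k\<in>UNIV. v $ k * ?p k)) (at f)"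
  proof (rule has_derivative_from_partials)
    show "(\<lambda>g. edge_length (\<C> g) i j) differentiable (at f)"
      unfolding edge_length_def
      using smooth_on_imp_differentiable[OF ij(1) f] smooth_on_imp_differentiable[OF ji(1) f]
      by (rule differentiable_add)
    show "has_partial_derivative (\<lambda>g. edge_length (\<C> g) i j) (?p k) k f" for k
    proof -
      consider "k = i" | "k = j" "k \<noteq> i" | "k \<noteq> i" "k \<noteq> j"
        by blast
      then show ?thesis
      proof cases
        case 1
        then show ?thesis
          using ij(2) by simp
      next
        \<comment> \<open>The length is symmetric, so its derivative in \<open>f j\<close> is the structure equation of the reversed edge.\<close>
        case 2
        then show ?thesis
          using ji(2) unfolding edge_length_commute[of _ i j] by simp
      next
        case 3
        then show ?thesis
          using DERIV_add[OF ij(3)[of k, unfolded has_partial_derivative_def] ji(3)[of k, unfolded has_partial_derivative_def]]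
          by (simp add: has_partial_derivative_def edge_length_def)
      qed
    qed
  qed
  moreover have "(\<Sum>k\<in>UNIV. v $ k * ?p k) = \<C> f i j * v $ i + \<C> f j i * v $ j" for v :: "real ^ 'a"
  proof -
    have "(\<Sum>k\<in>UNIV. v $ k * ?p k) = (\<Sum>k\<in>{i, j}. v $ k * ?p k)"
      by (rule sum.mono_neutral_right) auto
    then show ?thesis
      using \<open>i \<noteq> j\<close> by simp
  qed
  ultimately show ?thesis
    by simp
qed

text \<open>
  The derivative of the cosine \<open>(c\<^sup>2 + b\<^sup>2 - a\<^sup>2) / (2 * c * b)\<close>, as the quotient rule gives it, in the
  directions \<open>v\<close> of a conformal variation. The coefficients of \<open>vj\<close> and \<open>vk\<close> on the two sides agree by the two
  instances \<open>key\<close> of the linearized law of cosines. Those of \<open>vi\<close> then agree too, because constant \<open>v\<close>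
  only rescales the triangle, so that both sides vanish.
\<close>

lemma cosine_variation_identity:
  fixes x :: real
  assumes c: "c = dij + dji" and b: "b = dik + dki" and "b \<noteq> 0" "c \<noteq> 0"
    and key: "c * b * x = c * dji - a * djk + b * dik" "c * b * x = b * dki - a * dkj + c * dij"
    and c': "c' = dij * vi + dji * vj" and b': "b' = dik * vi + dki * vk" and a': "a' = djk * vj + dkj * vk"
  shows "(2 * c * c' + 2 * b * b' - 2 * a * a' - x * (2 * c' * b + 2 * c * b')) / (2 * c * b)
    = - ((dik - dij * x) / c * (vj - vi) + (dij - dik * x) / b * (vk - vi))"
proof -
  have "c * c' + b * b' - a * a' - x * (c' * b + c * b')
      + (b * (dik - dij * x) * (vj - vi) + c * (dij - dik * x) * (vk - vi))
      = vj * (c * dji - a * djk + b * dik - b * (dij + dji) * x)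
      + vk * (b * dki - a * dkj + c * dij - c * (dik + dki) * x)"
    unfolding c' b' a' by (simp add: algebra_simps)
  also have "\<dots> = 0"
    unfolding key[symmetric] c[symmetric] b[symmetric] by (simp add: algebra_simps)
  finally have "2 * c * c' + 2 * b * b' - 2 * a * a' - x * (2 * c' * b + 2 * c * b')
      = - (2 * (b * (dik - dij * x) * (vj - vi) + c * (dij - dik * x) * (vk - vi)))"
    by (simp add: algebra_simps)
  then have "(2 * c * c' + 2 * b * b' - 2 * a * a' - x * (2 * c' * b + 2 * c * b')) / (2 * c * b)
      = - (2 * (b * (dik - dij * x) * (vj - vi) + c * (dij - dik * x) * (vk - vi))) / (2 * c * b)"
    by simp
  also have "\<dots> = - ((dik - dij * x) / c * (vj - vi) + (dij - dik * x) / b * (vk - vi))"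
    using assms(3,4) by (simp add: field_simps)
  finally show ?thesis .
qed

text \<open>
  The geometric core: the derivative of the angle at \<open>i\<close> with respect to \<open>f\<^sub>j\<close> is the height over the edge
  \<open>{i, j}\<close> divided by its length. The factor \<open>s\<close>, the sine of the angle, from the derivative of \<open>arccos\<close>
  is the denominator of the heights.
\<close>

lemma triangle_angle_has_derivative:
  assumes conf: "conformal_structure T U \<C>" and T: "abstract_complex T" and U: "open U" "f \<in> U"
    and t: "{i, j, k} \<in> triangles T"
  shows "((\<lambda>g. triangle_angle (edge_length (\<C> g)) i {i, j, k}) has_derivative
    (\<lambda>v. center_height (\<C> f) i j k / edge_length (\<C> f) i j * (v $ j - v $ i)
       + center_height (\<C> f) i k j / edge_length (\<C> f) i k * (v $ k - v $ i))) (at f)"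
proof -
  let ?a = "\<lambda>g. edge_length (\<C> g) j k"
  let ?b = "\<lambda>g. edge_length (\<C> g) i k"
  let ?c = "\<lambda>g. edge_length (\<C> g) i j"
  let ?x = "\<lambda>g. cosine_from_lengths (edge_length (\<C> g)) i j k"
  let ?a' = "\<lambda>v. \<C> f j k * v $ j + \<C> f k j * v $ k"
  let ?b' = "\<lambda>v. \<C> f i k * v $ i + \<C> f k i * v $ k"
  let ?c' = "\<lambda>v. \<C> f i j * v $ i + \<C> f j i * v $ j"
  let ?H = "\<lambda>v. center_height (\<C> f) i j k / ?c f * (v $ j - v $ i)
    + center_height (\<C> f) i k j / ?b f * (v $ k - v $ i)"
  have t': "{i, k, j} \<in> triangles T" "{j, k, i} \<in> triangles T"
    using t by (simp_all add: insert_commute)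
  note met = conformal_structure_met[OF conf]
  note d = met[OF U(2)]
  have pos: "?c f > 0" "?b f > 0" "?a f > 0"
    using triangle_in_met(1)[OF d t] triangle_in_met(1)[OF d t'(1)] triangle_in_met(1)[OF d t'(2)] by auto
  have bnd: "\<bar>?x f\<bar> < 1"
    by (rule triangle_in_met(2)[OF d t])
  define s where "s = sqrt (1 - (?x f)\<^sup>2)"
  have s: "s > 0"
    using bnd by (simp add: s_def abs_square_less_1)
  have x_sym: "cosine_from_lengths l i k j = cosine_from_lengths l i j k" if "l j k = l k j" for l :: "'a \<Rightarrow> 'a \<Rightarrow> real"
    using that by (simp add: cosine_from_lengths_def ac_simps)
  have "cosine_from_lengths (edge_length (\<C> f)) i k j = ?x f"
    by (rule x_sym) (rule edge_length_commute)
  then have h: "center_height (\<C> f) i j k = (\<C> f i k - \<C> f i j * ?x f) / s"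
      "center_height (\<C> f) i k j = (\<C> f i j - \<C> f i k * ?x f) / s"
    using triangle_in_met(4)[OF d t] triangle_in_met(4)[OF d t'(1)] by (simp_all add: s_def)
  note len' = conformal_edge_length_has_derivative[OF conf U(2) triangle_edge[OF T]]
  have a': "(?a has_derivative ?a') (at f)" and b': "(?b has_derivative ?b') (at f)"
    and c': "(?c has_derivative ?c') (at f)"
    using len'[OF t'(2)] len'[OF t'(1)] len'[OF t] by auto
  have "((\<lambda>g. (?c g)\<^sup>2 + (?b g)\<^sup>2 - (?a g)\<^sup>2) has_derivative
      (\<lambda>v. 2 * ?c f * ?c' v + 2 * ?b f * ?b' v - 2 * ?a f * ?a' v)) (at f)"
    unfolding power2_eq_square
    by (rule has_derivative_eq_rhs, (rule derivative_intros a' b' c')+) (auto simp: algebra_simps)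
  moreover have "((\<lambda>g. 2 * ?c g * ?b g) has_derivative (\<lambda>v. 2 * ?c' v * ?b f + 2 * ?c f * ?b' v)) (at f)"
    by (rule has_derivative_eq_rhs, (rule derivative_intros b' c')+) (auto simp: algebra_simps)
  moreover have den: "2 * ?c f * ?b f \<noteq> 0"
    using pos by simp
  ultimately have "(?x has_derivative (\<lambda>v.
      ((2 * ?c f * ?c' v + 2 * ?b f * ?b' v - 2 * ?a f * ?a' v) * (2 * ?c f * ?b f)
        - ((?c f)\<^sup>2 + (?b f)\<^sup>2 - (?a f)\<^sup>2) * (2 * ?c' v * ?b f + 2 * ?c f * ?b' v))
      / ((2 * ?c f * ?b f) * (2 * ?c f * ?b f)))) (at f)"
    unfolding cosine_from_lengths_def by (rule has_derivative_divide')
  moreover have "((2 * ?c f * ?c' v + 2 * ?b f * ?b' v - 2 * ?a f * ?a' v) * (2 * ?c f * ?b f)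
        - ((?c f)\<^sup>2 + (?b f)\<^sup>2 - (?a f)\<^sup>2) * (2 * ?c' v * ?b f + 2 * ?c f * ?b' v))
      / ((2 * ?c f * ?b f) * (2 * ?c f * ?b f))
      = - s * ?H v"
    (is "?L = ?R") for v :: "real ^ 'a"
  proof -
    have x: "?x f = ((?c f)\<^sup>2 + (?b f)\<^sup>2 - (?a f)\<^sup>2) / (2 * ?c f * ?b f)"
      by (simp add: cosine_from_lengths_def)
    \<comment> \<open>The quotient rule, rewritten so that the cosine appears as itself.\<close>
    have quotient: "(n' * m - n * m') / (m * m) = (n' - n / m * m') / m" if "m \<noteq> 0" for n n' m m' :: real
      using that by (simp add: field_simps)
    have "?L = ((2 * ?c f * ?c' v + 2 * ?b f * ?b' v - 2 * ?a f * ?a' v)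
        - ?x f * (2 * ?c' v * ?b f + 2 * ?c f * ?b' v)) / (2 * ?c f * ?b f)"
      unfolding x by (rule quotient[OF den])
    also have "\<dots> = - ((\<C> f i k - \<C> f i j * ?x f) / ?c f * (v $ j - v $ i)
        + (\<C> f i j - \<C> f i k * ?x f) / ?b f * (v $ k - v $ i))"
    proof (rule cosine_variation_identity[OF _ _ _ _ _ _ refl refl refl])
      show "?c f * ?b f * ?x f = ?c f * \<C> f j i - ?a f * \<C> f j k + ?b f * \<C> f i k"
        by (rule cosine_from_partial_lengths[OF d t])
      show "?c f * ?b f * ?x f = ?b f * \<C> f k i - ?a f * \<C> f k j + ?c f * \<C> f i j"
        using cosine_from_partial_lengths[OF d t'(1)] \<open>cosine_from_lengths (edge_length (\<C> f)) i k j = ?x f\<close>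
        by (simp add: edge_length_commute[of _ k j] mult.commute)
    qed (use pos in \<open>auto simp: edge_length_def\<close>)
    also have "\<dots> = ?R"
    proof -
      have "s * (p / s / q * r) = p / q * r" for p q r :: real
        using s by simp
      then show ?thesis
        by (simp only: h distrib_left mult_minus_left)
    qed
    finally show ?thesis .
  qed
  ultimately have x': "(?x has_derivative (\<lambda>v. - s * ?H v)) (at f)"
    by simp
  have "((\<lambda>g. arccos (?x g)) has_derivative (\<lambda>v. - s * ?H v * inverse (- s))) (at f)"
    unfolding s_def using bnd by (intro has_derivative_arccos[OF _ _ x'[unfolded s_def]]) auto
  moreover have "- s * ?H v * inverse (- s) = ?H v" for v :: "real ^ 'a"
    using s by simp
  ultimately have "((\<lambda>g. arccos (?x g)) has_derivative ?H) (at f)"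
    by (simp only:)
  then show ?thesis
    by (rule has_derivative_transform_within_open[OF _ U])
      (simp add: triangle_in_met(3)[OF met t])
qed


section \<open>The derivative of the curvature\<close>

text \<open>
  Turns the sum over triangles in the curvature into one over ordered pairs of neighbours, which can be
  collected by edges.
\<close>

lemma sum_triangles_at_vertex:
  fixes g :: "'v::finite set \<Rightarrow> real"
  shows "(\<Sum>\<tau> | \<tau> \<in> triangles T \<and> i \<in> \<tau>. g \<tau>) = 1 / 2 * (\<Sum>j\<in>UNIV. \<Sum>k | {i, j, k} \<in> triangles T. g {i, j, k})"
proof -
  define P where "P = (SIGMA j:UNIV. {k. {i, j, k} \<in> triangles T})"
  let ?m = "\<lambda>(j, k). {i, j, k}"
  have group: "(\<Sum>\<tau> | \<tau> \<in> triangles T \<and> i \<in> \<tau>. \<Sum>q\<in>{q \<in> P. ?m q = \<tau>}. g (?m q)) = (\<Sum>q\<in>P. g (?m q))"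
    by (rule sum.group) (auto simp: P_def)
  \<comment> \<open>A triangle at \<open>i\<close> comes from the two orderings of its other two vertices.\<close>
  have fibre: "(\<Sum>q\<in>{q \<in> P. ?m q = \<tau>}. g (?m q)) = 2 * g \<tau>" if \<tau>: "\<tau> \<in> triangles T" "i \<in> \<tau>" for \<tau>
  proof -
    have "card (\<tau> - {i}) = 2"
      using \<tau> by (simp add: triangles_def)
    then obtain j k where jk: "\<tau> - {i} = {j, k}" "j \<noteq> k"
      by (meson card_2_iff)
    then have \<tau>_eq: "\<tau> = {i, j, k}"
      using \<tau>(2) by auto
    have "q \<in> P \<and> ?m q = \<tau> \<longleftrightarrow> q \<in> {(j, k), (k, j)}" for q
    proof
      obtain a b where q: "q = (a, b)"
        by (cases q)
      assume "q \<in> P \<and> ?m q = \<tau>"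
      then have ab: "{i, a, b} = \<tau>"
        using q by simp
      then have "{a, b} = \<tau> - {i}"
        using triangles_distinct[of i a b T] \<tau>(1) by auto
      then show "q \<in> {(j, k), (k, j)}"
        using jk(1) q by (simp add: doubleton_eq_iff)
    next
      assume "q \<in> {(j, k), (k, j)}"
      then show "q \<in> P \<and> ?m q = \<tau>"
        using \<tau>(1) \<tau>_eq by (auto simp: P_def insert_commute)
    qed
    then have "{q \<in> P. ?m q = \<tau>} = {(j, k), (k, j)}"
      by (intro set_eqI) (simp only: mem_Collect_eq)
    then show ?thesis
      using jk(2) \<tau>_eq by (simp add: insert_commute)
  qed
  have "2 * (\<Sum>\<tau> | \<tau> \<in> triangles T \<and> i \<in> \<tau>. g \<tau>) =
      (\<Sum>\<tau> | \<tau> \<in> triangles T \<and> i \<in> \<tau>. \<Sum>q\<in>{q \<in> P. ?m q = \<tau>}. g (?m q))"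
    unfolding sum_distrib_left by (intro sum.cong refl) (simp only: fibre mem_Collect_eq)
  also have "\<dots> = (\<Sum>q\<in>P. g (?m q))"
    by (rule group)
  also have "\<dots> = (\<Sum>j\<in>UNIV. \<Sum>k | {i, j, k} \<in> triangles T. g {i, j, k})"
    unfolding P_def by (subst sum.Sigma) (auto intro!: sum.cong)
  finally show ?thesis
    by simp
qed

text \<open>
  The conductances of the discrete Laplacian that is the derivative of the curvature.
\<close>

definition edge_weight :: "'v::finite set set \<Rightarrow> ('v \<Rightarrow> 'v \<Rightarrow> real) \<Rightarrow> 'v \<Rightarrow> 'v \<Rightarrow> real"
where
  "edge_weight T d i j = dual_length T d i j / edge_length d i j"

lemma edge_weight_commute: "d \<in> met T \<Longrightarrow> edge_weight T d i j = edge_weight T d j i"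
  by (simp add: edge_weight_def dual_length_commute edge_length_commute[of d i j])

lemma edge_weight_eq_0:
  assumes "abstract_complex T" "(i, j) \<notin> directed_edges T"
  shows "edge_weight T d i j = 0"
proof -
  have "{k. {i, j, k} \<in> triangles T} = {}"
    using triangle_edge[OF assms(1)] assms(2) by blast
  then show ?thesis
    by (simp add: edge_weight_def dual_length_def)
qed

text \<open>
  Adding the variations of the angles at \<open>i\<close>, each edge \<open>{i, j}\<close> collects the heights of its triangles,
  that is, its dual length.
\<close>

lemma curvature_has_derivative:
  assumes conf: "conformal_structure T U \<C>" and T: "abstract_complex T" and U: "open U" "f \<in> U"
  shows "((\<lambda>g. curvature T (\<C> g) i) has_derivative
    (\<lambda>v. \<Sum>j\<in>UNIV. edge_weight T (\<C> f) i j * (v $ i - v $ j))) (at f)"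
proof -
  let ?tri = "\<lambda>j k. {i, j, k} \<in> triangles T"
  let ?A = "\<lambda>v j k. center_height (\<C> f) i j k / edge_length (\<C> f) i j * (v $ j - v $ i)"
  have curv: "curvature T (\<C> g) i =
      2 * pi - 1 / 2 * (\<Sum>j\<in>UNIV. \<Sum>k | ?tri j k. triangle_angle (edge_length (\<C> g)) i {i, j, k})" for g
    unfolding curvature_def by (simp only: sum_triangles_at_vertex)
  have "((\<lambda>g. curvature T (\<C> g) i) has_derivative
      (\<lambda>v. 0 - 1 / 2 * (\<Sum>j\<in>UNIV. \<Sum>k | ?tri j k. ?A v j k + ?A v k j))) (at f)"
    unfolding curv
    by (intro has_derivative_diff has_derivative_const has_derivative_mult_right has_derivative_sum
        triangle_angle_has_derivative[OF conf T U]) simp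
  moreover have "0 - 1 / 2 * (\<Sum>j\<in>UNIV. \<Sum>k | ?tri j k. ?A v j k + ?A v k j)
      = (\<Sum>j\<in>UNIV. edge_weight T (\<C> f) i j * (v $ i - v $ j))" for v :: "real ^ 'a"
  proof -
    \<comment> \<open>Exchanging the roles of \<open>j\<close> and \<open>k\<close> cancels the factor \<open>1 / 2\<close>.\<close>
    have "(\<Sum>j\<in>UNIV. \<Sum>k | ?tri j k. ?A v k j) = (\<Sum>k\<in>UNIV. \<Sum>j | ?tri j k. ?A v k j)"
      using sum.swap_restrict[of UNIV UNIV "\<lambda>j k. ?A v k j" ?tri] by simp
    also have "\<dots> = (\<Sum>j\<in>UNIV. \<Sum>k | ?tri j k. ?A v j k)"
      by (simp add: insert_commute)
    finally have "0 - 1 / 2 * (\<Sum>j\<in>UNIV. \<Sum>k | ?tri j k. ?A v j k + ?A v k j)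
        = - (\<Sum>j\<in>UNIV. \<Sum>k | ?tri j k. ?A v j k)"
      by (simp add: sum.distrib)
    also have "\<dots> = (\<Sum>j\<in>UNIV. edge_weight T (\<C> f) i j * (v $ i - v $ j))"
      unfolding edge_weight_def dual_length_def sum_divide_distrib sum_distrib_right sum_negf[symmetric]
      by (simp only: minus_mult_right minus_diff_eq)
    finally show ?thesis .
  qed
  ultimately show ?thesis
    by simp
qed

text \<open>
  The existence of a potential requires a continuous derivative of the curvature, since it differentiates
  the work under the integral sign.
\<close>

lemma edge_weight_continuous_on:
  assumes conf: "conformal_structure T U \<C>" and T: "abstract_complex T"
  shows "continuous_on U (\<lambda>f. edge_weight T (\<C> f) i j)"
proof -
  note met = conformal_structure_met[OF conf]
  have "continuous_on U (\<lambda>f. center_height (\<C> f) i j k / edge_length (\<C> f) i j)" if t: "{i, j, k} \<in> triangles T" for k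
  proof -
    have t': "{i, k, j} \<in> triangles T" "{j, k, i} \<in> triangles T"
      using t by (simp_all add: insert_commute)
    have d_cont: "continuous_on U (\<lambda>f. \<C> f p q)" if "(p, q) \<in> directed_edges T" for p q
    proof (cases "U = {}")
      case False
      then obtain f where "f \<in> U"
        by blast
      then show ?thesis
        using conformal_structureD(1)[OF conf _ that] by (intro smooth_on_imp_continuous_on) blast
    qed simp
    have cont: "continuous_on U (\<lambda>f. \<C> f p q)" "continuous_on U (\<lambda>f. edge_length (\<C> f) p q)"
      if "(p, q) \<in> directed_edges T" for p q
      using that d_cont directed_edges_sym[of p q T] by (auto simp: edge_length_def intro!: continuous_intros)
    let ?x = "\<lambda>f. cosine_from_lengths (edge_length (\<C> f)) i j k"
    note e = triangle_edge[OF T t] triangle_edge[OF T t'(1)] triangle_edge[OF T t'(2)]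
    have pos: "edge_length (\<C> f) i j \<noteq> 0" "edge_length (\<C> f) i k \<noteq> 0" if "f \<in> U" for f
      using triangle_in_met(1)[OF met[OF that] t] triangle_in_met(1)[OF met[OF that] t'(1)] by auto
    have x: "continuous_on U ?x"
      unfolding cosine_from_lengths_def using pos by (intro continuous_intros cont e) simp
    have root: "sqrt (1 - (?x f)\<^sup>2) \<noteq> 0" if "f \<in> U" for f
    proof -
      have "(?x f)\<^sup>2 < 1"
        using triangle_in_met(2)[OF met[OF that] t] by (simp add: abs_square_less_1)
      then show ?thesis
        by simp
    qed
    have "continuous_on U (\<lambda>f. (\<C> f i k - \<C> f i j * ?x f) / sqrt (1 - (?x f)\<^sup>2) / edge_length (\<C> f) i j)"
      using pos root by (intro continuous_intros cont e x) blast+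
    then show ?thesis
      by (rule continuous_on_eq) (simp add: triangle_in_met(4)[OF met t])
  qed
  then show ?thesis
    unfolding edge_weight_def dual_length_def sum_divide_distrib by (intro continuous_on_sum) blast
qed

text \<open>
  The Dirichlet form of a weighted graph. It shows at once that the Laplacian is symmetric and that its
  quadratic form is the sum of squares in the second variation.
\<close>

lemma laplacian_bilinear_form:
  fixes w :: "'v::finite \<Rightarrow> 'v \<Rightarrow> real"
  assumes "\<And>i j. w i j = w j i"
  shows "(\<Sum>i\<in>UNIV. (\<Sum>j\<in>UNIV. w i j * (v i - v j)) * u i)
    = 1 / 2 * (\<Sum>i\<in>UNIV. \<Sum>j\<in>UNIV. w i j * (v i - v j) * (u i - u j))"
proof -
  \<comment> \<open>Summation by parts: average the sum with the one in which \<open>i\<close> and \<open>j\<close> are exchanged.\<close>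
  have "(\<Sum>i\<in>UNIV. \<Sum>j\<in>UNIV. w i j * (v i - v j) * u i) = (\<Sum>j\<in>UNIV. \<Sum>i\<in>UNIV. w i j * (v i - v j) * u i)"
    by (rule sum.swap)
  also have "\<dots> = - (\<Sum>i\<in>UNIV. \<Sum>j\<in>UNIV. w i j * (v i - v j) * u j)"
    unfolding sum_negf[symmetric] using assms by (intro sum.cong refl) (simp add: algebra_simps)
  finally have "(\<Sum>i\<in>UNIV. \<Sum>j\<in>UNIV. w i j * (v i - v j) * u i)
      = - (\<Sum>i\<in>UNIV. \<Sum>j\<in>UNIV. w i j * (v i - v j) * u j)" .
  moreover have "(\<Sum>i\<in>UNIV. \<Sum>j\<in>UNIV. w i j * (v i - v j) * (u i - u j))
      = (\<Sum>i\<in>UNIV. \<Sum>j\<in>UNIV. w i j * (v i - v j) * u i) - (\<Sum>i\<in>UNIV. \<Sum>j\<in>UNIV. w i j * (v i - v j) * u j)"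
    unfolding sum_subtractf[symmetric] by (intro sum.cong refl) (rule right_diff_distrib)
  ultimately show ?thesis
    unfolding sum_distrib_right by linarith
qed


section \<open>The curvature potential and its second variation\<close>

theorem theorem23:
  fixes M :: "'m topology"
    and T :: "'v::finite set set"
    and U :: "(real ^ 'v) set"
    and \<C> :: "real ^ 'v \<Rightarrow> 'v \<Rightarrow> 'v \<Rightarrow> real"
  assumes "closed_surface M"
    and "triangulates T M"
    and "open U"
    and "simply_connected U"
    and "conformal_structure T U \<C>"
  shows "\<exists>F :: real ^ 'v \<Rightarrow> real.
    (\<forall>f\<in>U. \<forall>i. has_partial_derivative F (curvature T (\<C> f) i) i f) \<and>
    (\<forall>\<epsilon>>0. \<forall>f :: real \<Rightarrow> real ^ 'v.
      smooth_on {-\<epsilon><..<\<epsilon>} f \<and> f ` {-\<epsilon><..<\<epsilon>} \<subseteq> U \<longrightarrow>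
      (\<forall>t\<in>{-\<epsilon><..<\<epsilon>}.
        has_second_derivative (\<lambda>s. F (f s))
          (1 / 2 * (\<Sum>(i, j)\<in>directed_edges T.
              dual_length T (\<C> (f t)) i j / edge_length (\<C> (f t)) i j *
              (deriv (\<lambda>s. f s $ j) t - deriv (\<lambda>s. f s $ i) t)\<^sup>2)
            + (\<Sum>i\<in>UNIV. curvature T (\<C> (f t)) i * deriv (deriv (\<lambda>s. f s $ i)) t))
          t))"
proof -
  note U = assms(3,4) and conf = assms(5)
  have T: "abstract_complex T"
    using assms(2) by (simp add: triangulates_def)
  define K where "K f = (\<chi> i. curvature T (\<C> f) i)" for f
  define K' where "K' f v = (\<chi> i. \<Sum>j\<in>UNIV. edge_weight T (\<C> f) i j * (v $ i - v $ j))" for f and v :: "real ^ 'v"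
  have w_sym: "edge_weight T (\<C> f) i j = edge_weight T (\<C> f) j i" if "f \<in> U" for f i j
    by (rule edge_weight_commute[OF conformal_structure_met[OF conf that]])
  have K': "(K has_derivative K' f) (at f)" if "f \<in> U" for f
  proof (rule iffD2[OF has_derivative_componentwise_within], rule ballI)
    fix b :: "real ^ 'v"
    assume "b \<in> Basis"
    then obtain i where "b = axis i 1"
      by (auto simp: Basis_vec_def)
    then show "((\<lambda>g. K g \<bullet> b) has_derivative (\<lambda>v. K' f v \<bullet> b)) (at f)"
      using curvature_has_derivative[OF conf T U(1) that, of i] by (simp add: K_def K'_def inner_axis)
  qed
  have K'_cont: "continuous_on U (\<lambda>f. K' f v)" for v
    unfolding K'_def by (intro continuous_intros edge_weight_continuous_on[OF conf T])
  have K'_form: "K' f v \<bullet> u = 1 / 2 * (\<Sum>i\<in>UNIV. \<Sum>j\<in>UNIV. edge_weight T (\<C> f) i j * (v $ i - v $ j) * (u $ i - u $ j))"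
    if "f \<in> U" for f v u
    using laplacian_bilinear_form[of "edge_weight T (\<C> f)" "($) v" "($) u", OF w_sym[OF that]]
    by (simp add: K'_def inner_vec_def)
  have K'_sym: "K' f v \<bullet> u = K' f u \<bullet> v" if "f \<in> U" for f u v
    unfolding K'_form[OF that] by (simp add: mult.assoc mult.commute[of "u $ _ - u $ _"])
  obtain F where F: "\<And>f. f \<in> U \<Longrightarrow> (F has_derivative (\<lambda>v. K f \<bullet> v)) (at f)"
    using closed_field_has_potential[OF U K' K'_cont K'_sym] by metis
  \<comment> \<open>Pairs that are not edges have weight 0, so the double sum is one over directed edges.\<close>
  have quadratic: "K' f v \<bullet> v = 1 / 2 * (\<Sum>(i, j)\<in>directed_edges T.
      dual_length T (\<C> f) i j / edge_length (\<C> f) i j * (v $ j - v $ i)\<^sup>2)" if "f \<in> U" for f v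
  proof -
    have square: "w * (a - b) * (a - b) = w * (b - a)\<^sup>2" for w a b :: real
      by (simp add: power2_eq_square algebra_simps)
    have "(\<Sum>i\<in>UNIV. \<Sum>j\<in>UNIV. edge_weight T (\<C> f) i j * (v $ i - v $ j) * (v $ i - v $ j))
        = (\<Sum>(i, j)\<in>UNIV. edge_weight T (\<C> f) i j * (v $ j - v $ i)\<^sup>2)"
      by (simp only: square sum.cartesian_product UNIV_Times_UNIV)
    also have "\<dots> = (\<Sum>(i, j)\<in>directed_edges T. edge_weight T (\<C> f) i j * (v $ j - v $ i)\<^sup>2)"
      by (rule sum.mono_neutral_right) (auto simp: edge_weight_eq_0[OF T])
    finally show ?thesis
      unfolding K'_form[OF that] edge_weight_def by simp
  qed
  show ?thesis
  proof (intro exI[of _ F] conjI ballI allI impI)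
    fix f i
    assume "f \<in> U"
    then show "has_partial_derivative F (curvature T (\<C> f) i) i f"
      using has_derivative_imp_partial[OF F, of f i] by (simp add: K_def inner_axis)
  next
    fix \<epsilon> :: real and f :: "real \<Rightarrow> real ^ 'v" and t
    assume f: "smooth_on {-\<epsilon><..<\<epsilon>} f \<and> f ` {-\<epsilon><..<\<epsilon>} \<subseteq> U" and t: "t \<in> {-\<epsilon><..<\<epsilon>}"
    then have "f t \<in> U"
      by blast
    from second_derivative_of_potential_along_curve[OF F K' open_greaterThanLessThan t conjunct1[OF f] conjunct2[OF f]]
    show "has_second_derivative (\<lambda>s. F (f s))
          (1 / 2 * (\<Sum>(i, j)\<in>directed_edges T.
              dual_length T (\<C> (f t)) i j / edge_length (\<C> (f t)) i j *
              (deriv (\<lambda>s. f s $ j) t - deriv (\<lambda>s. f s $ i) t)\<^sup>2)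
            + (\<Sum>i\<in>UNIV. curvature T (\<C> (f t)) i * deriv (deriv (\<lambda>s. f s $ i)) t)) t"
      unfolding quadratic[OF \<open>f t \<in> U\<close>] by (simp add: K_def)
  qed
qed

end
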